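(* Let $P$ and $Q$ be pseudo-Riemannian manifolds of real dimension $n$ that are related through a standard Wick-rotation at a common point $m$, inside a holomorphic Riemannian manifold $(M,g)$ of complex dimension $n$. Let $P$ have signature $(p,q)$, $p+q=n$, and let $Q$ be a Riemannian space (positive definite metric). Suppose $x\in V$ and $\tilde x\in\tilde V$ are two Wick-rotatable tensors at $m$. Then the real orbits $O(p,q)x$ and $O(n)\tilde x$ intersect: $$O(p,q)\,x\cap O(n)\,\tilde x\neq\emptyset .$$
   Context: A holomorphic Riemannian manifold $(M,g)$ is a complex manifold with a holomorphic symmetric non-degenerate $\mathbb C$-bilinear form $g$ on its holomorphic tangent bundle. A real slice of a complex vector space with non-degenerate symmetric $\mathbb C$-bilinear form $(E,g)$ is a real linear subspace $W\subset E$ on which $g$ is real valued and non-degenerate (this implies $W\cap iW=0$). A real slice of $(M,g)$ is a submanifold $N$ such that $T_yN$ is a real slice of $(T_yM,g)$ for all $y\in N$; it is pseudo-Riemannian with the induced metric. Real dimensions of $P$, $Q$ and the complex dimension of $M$ are assumed equal (to $n$). $P$ and $Q$ are Wick-related if both are embedded as real slices of the same $(M,g)$, and Wick-rotated with respect to $m$ if in addition they intersect at $m\in M$. They are related through a standard Wick-rotation at $m$ if moreover $T_mP$, $T_mQ$, embedded as real forms of $(T_mP)^{\mathbb C}\cong(T_mQ)^{\mathbb C}\cong T_mM$, form a compatible triple: there is a third real slice $W$ of $T_mM$, also a real form, on which $g$ is positive definite, such that the conjugation maps of $T_mP,T_mQ,W$ (the antilinear involutions of $T_mM$ fixing each of them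 pointwise) commute pairwise. The group $O(n,\mathbb C)$ is the group of $\mathbb C$-linear maps of $T_mM$ preserving $g$; $O(p,q)\subset O(n,\mathbb C)$ and $O(n)\subset O(n,\mathbb C)$ are the subgroups preserving $T_mP$ and $T_mQ$ respectively (the structure groups of $P$ and $Q$). $V$ is a space of tensors of some fixed type (or finite direct sum of such) over $T_mP$, $\tilde V$ the space of tensors of the same type over $T_mQ$; both are real forms of the space $V^{\mathbb C}$ of complex tensors of that type over $T_mM$, on which $O(n,\mathbb C)$ acts tensorially. Tensors $x\in V$ and $\tilde x\in\tilde V$ are called Wick-rotatable if they lie in the same complex orbit: $O(n,\mathbb C)x=O(n,\mathbb C)\tilde x$. *)

theory Defs
  imports "HOL-Analysis.Analysis" "HOL-Library.Function_Algebras"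
begin

section \<open>Holomorphic and smooth maps\<close>

text \<open>Holomorphy for open \<open>S\<close>: differentiability with complex linear derivative.\<close>

definition holo_fun_on :: "(complex^'n::finite \<Rightarrow> complex) \<Rightarrow> (complex^'n) set \<Rightarrow> bool" where
  "holo_fun_on f S \<longleftrightarrow>
     (\<forall>z\<in>S. \<exists>f'. (f has_derivative f') (at z) \<and> (\<forall>c v. f' (c *s v) = c * f' v))"

definition holo_map_on :: "(complex^'n::finite \<Rightarrow> complex^'k::finite) \<Rightarrow> (complex^'n) set \<Rightarrow> bool" where
  "holo_map_on f S \<longleftrightarrow> (\<forall>i. holo_fun_on (\<lambda>z. f z $ i) S)"

text \<open>\<open>C\<^sup>k\<close> and \<open>C\<^sup>\<infinity>\<close> maps on an open subset \<open>S\<close> of a finite-dimensional real space; there it is enough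
  that every iterated directional derivative exists and is continuous.\<close>

primrec Ck_on :: "nat \<Rightarrow> ('a::euclidean_space \<Rightarrow> 'b::euclidean_space) \<Rightarrow> 'a set \<Rightarrow> bool" where
  "Ck_on 0 f S \<longleftrightarrow> continuous_on S f"
| "Ck_on (Suc k) f S \<longleftrightarrow>
     (\<forall>x\<in>S. f differentiable (at x)) \<and> (\<forall>v. Ck_on k (\<lambda>x. frechet_derivative f (at x) v) S)"

definition smooth_on :: "('a::euclidean_space \<Rightarrow> 'b::euclidean_space) \<Rightarrow> 'a set \<Rightarrow> bool" where
  "smooth_on f S \<longleftrightarrow> (\<forall>k. Ck_on k f S)"

definition smooth_diffeo_on :: "('a::euclidean_space \<Rightarrow> 'b::euclidean_space) \<Rightarrow> 'a set \<Rightarrow> bool" where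
  "smooth_diffeo_on F S \<longleftrightarrow> open S \<and> open (F ` S) \<and> inj_on F S \<and>
     smooth_on F S \<and> smooth_on (inv_into S F) (F ` S)"


section \<open>Complex manifolds and their holomorphic tangent spaces\<close>

text \<open>A chart is a domain together with a coordinate map whose values outside the domain are irrelevant.\<close>

type_synonym ('m, 'n) chart = "'m set \<times> ('m \<Rightarrow> complex^'n)"

definition chart_inv :: "('m, 'n::finite) chart \<Rightarrow> complex^'n \<Rightarrow> 'm" where
  "chart_inv c = inv_into (fst c) (snd c)"

definition transition :: "('m, 'n::finite) chart \<Rightarrow> ('m, 'n) chart \<Rightarrow> complex^'n \<Rightarrow> complex^'n" where
  "transition c d = snd d \<circ> chart_inv c"

definition complex_manifold :: "'m topology \<Rightarrow> ('m, 'n::finite) chart set \<Rightarrow> bool" where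
  "complex_manifold X A \<longleftrightarrow>
     Hausdorff_space X \<and> second_countable X \<and>
     (\<Union>c\<in>A. fst c) = topspace X \<and>
     (\<forall>c\<in>A. openin X (fst c) \<and> open (snd c ` fst c) \<and>
        homeomorphic_map (subtopology X (fst c)) (top_of_set (snd c ` fst c)) (snd c)) \<and>
     (\<forall>c\<in>A. \<forall>d\<in>A. holo_map_on (transition c d) (snd c ` (fst c \<inter> fst d)))"

definition charts_at :: "('m, 'n::finite) chart set \<Rightarrow> 'm \<Rightarrow> ('m, 'n) chart set" where
  "charts_at A y = {c\<in>A. y \<in> fst c}"

text \<open>A tangent vector at \<open>y\<close> is its family of components in all charts around \<open>y\<close>, related to each
  other by the derivatives of the coordinate changes. It is padded with \<open>0\<close> at all other charts, so that
  addition and zero are the pointwise ones of \<^theory>\<open>HOL-Library.Function_Algebras\<close>.\<close>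

type_synonym ('m, 'n) tvec = "('m, 'n) chart \<Rightarrow> complex^'n"

definition tangent_space ::
  "('m, 'n::finite) chart set \<Rightarrow> 'm \<Rightarrow> ('m, 'n) tvec set" where
  "tangent_space A y = {v.
     (\<forall>c\<in>charts_at A y. \<forall>d\<in>charts_at A y.
        v d = frechet_derivative (transition c d) (at (snd c y)) (v c)) \<and>
     (\<forall>c. c \<notin> charts_at A y \<longrightarrow> v c = 0)}"

text \<open>The tangent vector at \<open>y\<close> with constant components \<open>a\<close> in the chart \<open>c\<close>.\<close>

definition coord_vec ::
  "('m, 'n::finite) chart set \<Rightarrow> ('m, 'n) chart \<Rightarrow> complex^'n \<Rightarrow> 'm \<Rightarrow> ('m, 'n) tvec" where
  "coord_vec A c a y =
     (\<lambda>d. if d \<in> charts_at A y then frechet_derivative (transition c d) (at (snd c y)) a else 0)"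


section \<open>Linear algebra in a complex tangent space\<close>

definition cscale :: "complex \<Rightarrow> ('i \<Rightarrow> complex^'n::finite) \<Rightarrow> ('i \<Rightarrow> complex^'n)" where
  "cscale c v = (\<lambda>i. c *s v i)"

definition rscale :: "real \<Rightarrow> ('i \<Rightarrow> complex^'n::finite) \<Rightarrow> ('i \<Rightarrow> complex^'n)" where
  "rscale r = cscale (complex_of_real r)"

interpretation cvec: vector_space cscale
  by unfold_locales
     (auto simp: cscale_def fun_eq_iff vec_eq_iff algebra_simps)

interpretation rvec: vector_space rscale
  by unfold_locales
     (auto simp: rscale_def cscale_def fun_eq_iff vec_eq_iff algebra_simps)

definition nondegenerate_on :: "'v::zero set \<Rightarrow> ('v \<Rightarrow> 'v \<Rightarrow> complex) \<Rightarrow> bool" where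
  "nondegenerate_on W b \<longleftrightarrow> (\<forall>u\<in>W. (\<forall>w\<in>W. b u w = 0) \<longrightarrow> u = 0)"

definition complex_metric_on ::
  "('i \<Rightarrow> complex^'n::finite) set \<Rightarrow> (('i \<Rightarrow> complex^'n) \<Rightarrow> ('i \<Rightarrow> complex^'n) \<Rightarrow> complex) \<Rightarrow> bool" where
  "complex_metric_on E b \<longleftrightarrow>
     (\<forall>u\<in>E. \<forall>v\<in>E. b u v = b v u) \<and>
     (\<forall>u\<in>E. \<forall>v\<in>E. \<forall>w\<in>E. b (u + v) w = b u w + b v w) \<and>
     (\<forall>c. \<forall>u\<in>E. \<forall>w\<in>E. b (cscale c u) w = c * b u w) \<and>
     nondegenerate_on E b"

definition real_slice ::
  "('i \<Rightarrow> complex^'n::finite) set \<Rightarrow> (('i \<Rightarrow> complex^'n) \<Rightarrow> ('i \<Rightarrow> complex^'n) \<Rightarrow> complex)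
     \<Rightarrow> ('i \<Rightarrow> complex^'n) set \<Rightarrow> bool" where
  "real_slice E b W \<longleftrightarrow> W \<subseteq> E \<and> rvec.subspace W \<and>
     (\<forall>u\<in>W. \<forall>w\<in>W. b u w \<in> \<real>) \<and> nondegenerate_on W b"

definition real_form :: "('i \<Rightarrow> complex^'n::finite) set \<Rightarrow> ('i \<Rightarrow> complex^'n) set \<Rightarrow> bool" where
  "real_form E W \<longleftrightarrow> rvec.subspace W \<and> W \<inter> cscale \<i> ` W = {0} \<and>
     E = {u + cscale \<i> w |u w. u \<in> W \<and> w \<in> W}"

text \<open>The conjugation of a real form is determined by this only on \<open>E\<close>.\<close>

definition conjugation_of ::
  "('i \<Rightarrow> complex^'n::finite) set \<Rightarrow> ('i \<Rightarrow> complex^'n) set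
     \<Rightarrow> (('i \<Rightarrow> complex^'n) \<Rightarrow> ('i \<Rightarrow> complex^'n)) \<Rightarrow> bool" where
  "conjugation_of E W s \<longleftrightarrow> s ` E \<subseteq> E \<and>
     (\<forall>u\<in>E. \<forall>v\<in>E. s (u + v) = s u + s v) \<and>
     (\<forall>c. \<forall>u\<in>E. s (cscale c u) = cscale (cnj c) (s u)) \<and>
     (\<forall>u\<in>E. s (s u) = u) \<and> (\<forall>w\<in>W. s w = w)"

definition commute_on :: "'v set \<Rightarrow> ('v \<Rightarrow> 'v) \<Rightarrow> ('v \<Rightarrow> 'v) \<Rightarrow> bool" where
  "commute_on E s t \<longleftrightarrow> (\<forall>u\<in>E. s (t u) = t (s u))"

definition positive_definite_on :: "'v::zero set \<Rightarrow> ('v \<Rightarrow> 'v \<Rightarrow> complex) \<Rightarrow> bool" where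
  "positive_definite_on W b \<longleftrightarrow> (\<forall>w\<in>W. b w w \<in> \<real> \<and> (w \<noteq> 0 \<longrightarrow> Re (b w w) > 0))"

definition compatible_triple ::
  "('i \<Rightarrow> complex^'n::finite) set \<Rightarrow> (('i \<Rightarrow> complex^'n) \<Rightarrow> ('i \<Rightarrow> complex^'n) \<Rightarrow> complex)
     \<Rightarrow> ('i \<Rightarrow> complex^'n) set \<Rightarrow> ('i \<Rightarrow> complex^'n) set \<Rightarrow> ('i \<Rightarrow> complex^'n) set \<Rightarrow> bool" where
  "compatible_triple E b W1 W2 W \<longleftrightarrow>
     (\<forall>W'\<in>{W1, W2, W}. real_slice E b W' \<and> real_form E W') \<and>
     positive_definite_on W b \<and>
     (\<exists>s1 s2 s. conjugation_of E W1 s1 \<and> conjugation_of E W2 s2 \<and> conjugation_of E W s \<and>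
        commute_on E s1 s2 \<and> commute_on E s1 s \<and> commute_on E s2 s)"

text \<open>Signature \<open>(p, q)\<close>: \<open>p\<close> is the number of positive directions. The spanning family \<open>e\<close> is a basis of \<open>W\<close>,
  its linear independence being forced by the orthonormality relations.\<close>

definition has_signature ::
  "('i \<Rightarrow> complex^'n::finite) set \<Rightarrow> (('i \<Rightarrow> complex^'n) \<Rightarrow> ('i \<Rightarrow> complex^'n) \<Rightarrow> complex)
     \<Rightarrow> nat \<Rightarrow> nat \<Rightarrow> bool" where
  "has_signature W b p q \<longleftrightarrow> (\<exists>e :: nat \<Rightarrow> 'i \<Rightarrow> complex^'n.
     rvec.span (e ` {..<p + q}) = W \<and>
     (\<forall>j<p + q. \<forall>k<p + q. b (e j) (e k) = (if j \<noteq> k then 0 else if j < p then 1 else -1)))"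


section \<open>Holomorphic Riemannian manifolds, real slices, Wick-rotations\<close>

definition holomorphic_riemannian_manifold ::
  "'m topology \<Rightarrow> ('m, 'n::finite) chart set
     \<Rightarrow> ('m \<Rightarrow> ('m, 'n) tvec \<Rightarrow> ('m, 'n) tvec \<Rightarrow> complex) \<Rightarrow> bool" where
  "holomorphic_riemannian_manifold X A g \<longleftrightarrow>
     complex_manifold X A \<and>
     (\<forall>y\<in>topspace X. complex_metric_on (tangent_space A y) (g y)) \<and>
     (\<forall>c\<in>A. \<forall>a b. holo_fun_on
        (\<lambda>z. g (chart_inv c z) (coord_vec A c a (chart_inv c z)) (coord_vec A c b (chart_inv c z)))
        (snd c ` fst c))"

text \<open>Embedded \<open>C\<^sup>\<infinity>\<close> submanifolds of half the real dimension of \<open>M\<close> (real dimension \<open>n\<close> where \<open>M\<close> has complex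
  dimension \<open>n\<close>), via slice charts.\<close>

definition half_dim_submanifold :: "'m topology \<Rightarrow> ('m, 'n::finite) chart set \<Rightarrow> 'm set \<Rightarrow> bool" where
  "half_dim_submanifold X A N \<longleftrightarrow> N \<subseteq> topspace X \<and>
     (\<forall>y\<in>N. \<exists>c\<in>A. \<exists>U. \<exists>F :: complex^'n \<Rightarrow> (real^'n) \<times> (real^'n).
        openin X U \<and> y \<in> U \<and> U \<subseteq> fst c \<and> smooth_diffeo_on F (snd c ` U) \<and>
        F ` snd c ` (N \<inter> U) = F ` snd c ` U \<inter> {(s, t). t = 0})"

text \<open>\<open>T\<^sub>yN\<close> inside \<open>T\<^sub>yM\<close>: velocities of smooth curves in \<open>N\<close> through \<open>y\<close>. The real tangent space of \<open>M\<close> is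
  identified with the holomorphic one in the usual way, by its components in holomorphic charts.\<close>

definition submanifold_tangent_space ::
  "('m, 'n::finite) chart set \<Rightarrow> 'm set \<Rightarrow> 'm \<Rightarrow> ('m, 'n) tvec set" where
  "submanifold_tangent_space A N y = {v \<in> tangent_space A y. \<exists>\<gamma> :: real \<Rightarrow> 'm. \<gamma> 0 = y \<and>
     (\<forall>c\<in>charts_at A y. \<exists>\<epsilon>>0. \<gamma> ` {-\<epsilon><..<\<epsilon>} \<subseteq> N \<inter> fst c \<and>
        smooth_on (snd c \<circ> \<gamma>) {-\<epsilon><..<\<epsilon>} \<and>
        ((snd c \<circ> \<gamma>) has_vector_derivative v c) (at 0))}"

definition real_slice_submanifold ::
  "'m topology \<Rightarrow> ('m, 'n::finite) chart set
     \<Rightarrow> ('m \<Rightarrow> ('m, 'n) tvec \<Rightarrow> ('m, 'n) tvec \<Rightarrow> complex) \<Rightarrow> 'm set \<Rightarrow> bool" where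
  "real_slice_submanifold X A g N \<longleftrightarrow> half_dim_submanifold X A N \<and>
     (\<forall>y\<in>N. real_slice (tangent_space A y) (g y) (submanifold_tangent_space A N y))"

definition wick_related ::
  "'m topology \<Rightarrow> ('m, 'n::finite) chart set
     \<Rightarrow> ('m \<Rightarrow> ('m, 'n) tvec \<Rightarrow> ('m, 'n) tvec \<Rightarrow> complex) \<Rightarrow> 'm set \<Rightarrow> 'm set \<Rightarrow> bool" where
  "wick_related X A g P Q \<longleftrightarrow>
     real_slice_submanifold X A g P \<and> real_slice_submanifold X A g Q"

definition wick_rotated ::
  "'m topology \<Rightarrow> ('m, 'n::finite) chart set
     \<Rightarrow> ('m \<Rightarrow> ('m, 'n) tvec \<Rightarrow> ('m, 'n) tvec \<Rightarrow> complex) \<Rightarrow> 'm set \<Rightarrow> 'm set \<Rightarrow> 'm \<Rightarrow> bool" where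
  "wick_rotated X A g P Q m \<longleftrightarrow> wick_related X A g P Q \<and> m \<in> P \<inter> Q"

definition standard_wick_rotation ::
  "'m topology \<Rightarrow> ('m, 'n::finite) chart set
     \<Rightarrow> ('m \<Rightarrow> ('m, 'n) tvec \<Rightarrow> ('m, 'n) tvec \<Rightarrow> complex) \<Rightarrow> 'm set \<Rightarrow> 'm set \<Rightarrow> 'm \<Rightarrow> bool" where
  "standard_wick_rotation X A g P Q m \<longleftrightarrow> wick_rotated X A g P Q m \<and>
     (\<exists>W. compatible_triple (tangent_space A m) (g m)
        (submanifold_tangent_space A P m) (submanifold_tangent_space A Q m) W)"


section \<open>Tensors and orthogonal groups\<close>

text \<open>Dual space of \<open>E\<close>; functionals are padded with \<open>0\<close> outside \<open>E\<close>, so that equality is equality on \<open>E\<close>.\<close>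

definition dual_space ::
  "('i \<Rightarrow> complex^'n::finite) set \<Rightarrow> (('i \<Rightarrow> complex^'n) \<Rightarrow> complex) set" where
  "dual_space E = {\<alpha>. (\<forall>u\<in>E. \<forall>v\<in>E. \<alpha> (u + v) = \<alpha> u + \<alpha> v) \<and>
     (\<forall>c. \<forall>u\<in>E. \<alpha> (cscale c u) = c * \<alpha> u) \<and> (\<forall>u. u \<notin> E \<longrightarrow> \<alpha> u = 0)}"

type_synonym ('i, 'n) tensor =
  "(('i \<Rightarrow> complex^'n) \<Rightarrow> complex) list \<Rightarrow> ('i \<Rightarrow> complex^'n) list \<Rightarrow> complex"

text \<open>Tensors of type \<open>(k, l)\<close>: complex multilinear functions of \<open>k\<close> covectors and \<open>l\<close> vectors, padded with \<open>0\<close>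
  outside their domain.\<close>

definition tensor_args ::
  "('i \<Rightarrow> complex^'n::finite) set \<Rightarrow> nat \<times> nat
     \<Rightarrow> ((('i \<Rightarrow> complex^'n) \<Rightarrow> complex) list \<times> ('i \<Rightarrow> complex^'n) list) set" where
  "tensor_args E ty = {(as, vs). length as = fst ty \<and> length vs = snd ty \<and>
     set as \<subseteq> dual_space E \<and> set vs \<subseteq> E}"

definition complex_tensors ::
  "('i \<Rightarrow> complex^'n::finite) set \<Rightarrow> nat \<times> nat \<Rightarrow> ('i, 'n) tensor set" where
  "complex_tensors E ty = {t.
     (\<forall>as vs. (as, vs) \<in> tensor_args E ty \<longrightarrow>
        (\<forall>j<fst ty. \<forall>\<alpha>\<in>dual_space E. \<forall>\<beta>\<in>dual_space E. \<forall>c.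
           t (as[j := (\<lambda>u. \<alpha> u + c * \<beta> u)]) vs = t (as[j := \<alpha>]) vs + c * t (as[j := \<beta>]) vs) \<and>
        (\<forall>j<snd ty. \<forall>u\<in>E. \<forall>w\<in>E. \<forall>c.
           t as (vs[j := u + cscale c w]) = t as (vs[j := u]) + c * t as (vs[j := w]))) \<and>
     (\<forall>as vs. (as, vs) \<notin> tensor_args E ty \<longrightarrow> t as vs = 0)}"

text \<open>Tensors over a real form \<open>W\<close> of \<open>E\<close>, as a real form of the complex tensors over \<open>E\<close>: a real multilinear
  function of covectors and vectors of \<open>W\<close> is identified with its complex multilinear extension. The
  tensors so obtained are those with real values on vectors of \<open>W\<close> and on covectors of \<open>W\<close>, i.e.
  functionals on \<open>E\<close> that are real on \<open>W\<close>.\<close>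

definition real_tensors ::
  "('i \<Rightarrow> complex^'n::finite) set \<Rightarrow> ('i \<Rightarrow> complex^'n) set \<Rightarrow> nat \<times> nat \<Rightarrow> ('i, 'n) tensor set" where
  "real_tensors E W ty = {t \<in> complex_tensors E ty.
     \<forall>as vs. (as, vs) \<in> tensor_args E ty \<and> (\<forall>\<alpha>\<in>set as. \<alpha> ` W \<subseteq> \<real>) \<and> set vs \<subseteq> W \<longrightarrow> t as vs \<in> \<real>}"

text \<open>Finite direct sums of tensor spaces: one summand for each type in the list \<open>tys\<close>.\<close>

definition real_tensor_sum ::
  "('i \<Rightarrow> complex^'n::finite) set \<Rightarrow> ('i \<Rightarrow> complex^'n) set \<Rightarrow> (nat \<times> nat) list
     \<Rightarrow> ('i, 'n) tensor list set" where
  "real_tensor_sum E W tys = {x. list_all2 (\<lambda>t ty. t \<in> real_tensors E W ty) x tys}"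

definition orthogonal_group ::
  "('i \<Rightarrow> complex^'n::finite) set \<Rightarrow> (('i \<Rightarrow> complex^'n) \<Rightarrow> ('i \<Rightarrow> complex^'n) \<Rightarrow> complex)
     \<Rightarrow> (('i \<Rightarrow> complex^'n) \<Rightarrow> ('i \<Rightarrow> complex^'n)) set" where
  "orthogonal_group E b = {h. bij_betw h E E \<and>
     (\<forall>u\<in>E. \<forall>v\<in>E. h (u + v) = h u + h v) \<and> (\<forall>c. \<forall>u\<in>E. h (cscale c u) = cscale c (h u)) \<and>
     (\<forall>u\<in>E. \<forall>v\<in>E. b (h u) (h v) = b u v)}"

definition real_orthogonal_group ::
  "('i \<Rightarrow> complex^'n::finite) set \<Rightarrow> (('i \<Rightarrow> complex^'n) \<Rightarrow> ('i \<Rightarrow> complex^'n) \<Rightarrow> complex)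
     \<Rightarrow> ('i \<Rightarrow> complex^'n) set \<Rightarrow> (('i \<Rightarrow> complex^'n) \<Rightarrow> ('i \<Rightarrow> complex^'n)) set" where
  "real_orthogonal_group E b W = {h \<in> orthogonal_group E b. h ` W = W}"

text \<open>\<open>h\<close> acts on tensors by \<open>(h t)(\<alpha>, \<dots>, v, \<dots>) = t(\<alpha> \<circ> h, \<dots>, h\<^sup>-\<^sup>1 v, \<dots>)\<close>.\<close>

definition tensor_act ::
  "('i \<Rightarrow> complex^'n::finite) set \<Rightarrow> (('i \<Rightarrow> complex^'n) \<Rightarrow> ('i \<Rightarrow> complex^'n))
     \<Rightarrow> ('i, 'n) tensor \<Rightarrow> ('i, 'n) tensor" where
  "tensor_act E h t = (\<lambda>as vs. if set as \<subseteq> dual_space E \<and> set vs \<subseteq> E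
     then t (map (\<lambda>\<alpha> u. if u \<in> E then \<alpha> (h u) else 0) as) (map (inv_into E h) vs) else 0)"

definition tensor_orbit ::
  "('i \<Rightarrow> complex^'n::finite) set \<Rightarrow> (('i \<Rightarrow> complex^'n) \<Rightarrow> ('i \<Rightarrow> complex^'n)) set
     \<Rightarrow> ('i, 'n) tensor list \<Rightarrow> ('i, 'n) tensor list set" where
  "tensor_orbit E G x = {map (tensor_act E h) x |h. h \<in> G}"

definition wick_rotatable ::
  "('i \<Rightarrow> complex^'n::finite) set \<Rightarrow> (('i \<Rightarrow> complex^'n) \<Rightarrow> ('i \<Rightarrow> complex^'n) \<Rightarrow> complex)
     \<Rightarrow> ('i, 'n) tensor list \<Rightarrow> ('i, 'n) tensor list \<Rightarrow> bool" where
  "wick_rotatable E b x x' \<longleftrightarrow>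
     tensor_orbit E (orthogonal_group E b) x = tensor_orbit E (orthogonal_group E b) x'"

end

theory Submission
  imports Defs
begin

text \<open>An orthonormal basis of \<open>T\<^sub>mQ\<close> identifies \<open>T\<^sub>mM\<close> with \<open>\<complex>\<^sup>n\<close>, with its standard bilinear form; the
  conjugation of \<open>T\<^sub>mQ\<close> becomes the standard one and that of \<open>T\<^sub>mP\<close> becomes \<open>z \<mapsto> \<theta> z\<^sup>*\<close> for a real
  orthogonal involution \<open>\<theta>\<close>. If \<open>h \<in> O(n,\<complex>)\<close> takes \<open>x\<close> to \<open>x'\<close>, then, \<open>x\<close> and \<open>x'\<close> being fixed by the two
  conjugations, \<open>x\<close> is fixed by \<open>\<theta> a\<close>, where \<open>a = h\<^sup>* h\<close>. A tensor fixed by \<open>r\<^sup>2\<close> is also fixed by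
  \<open>r\<close>, if \<open>r\<close> is a positive hermitian element of \<open>O(n,\<complex>)\<close>, since \<open>r\<close> has positive eigenvalues on tensors.
  This gives \<open>c x = a x\<close> for the geometric mean \<open>c\<close> of \<open>a\<close> and \<open>(\<theta> a \<theta>)\<^sup>-\<^sup>1\<close>, which satisfies
  \<open>\<theta> c \<theta> = c\<^sup>-\<^sup>1\<close>, so that \<open>s = \<surd>c\<close> preserves \<open>T\<^sub>mP\<close>. In the polar decomposition \<open>s h\<^sup>-\<^sup>1 = k r\<close> with
  \<open>k\<close> unitary, \<open>k\<close> preserves \<open>T\<^sub>mQ\<close>; as \<open>r\<^sup>2\<close> fixes \<open>x'\<close>, so does \<open>r\<close>, whence \<open>s x = k x'\<close>.\<close>

section \<open>Spectral theorem and square roots\<close>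

text \<open>The first-order condition at a maximum: for small \<open>t\<close> of the sign of
  \<open>b\<close> the linear term would dominate.\<close>

lemma quadratic_nonpos_imp_linear_coeff_zero:
  fixes b c :: real
  assumes "\<And>t. t * b + t\<^sup>2 * c \<le> 0"
  shows "b = 0"
proof (rule ccontr)
  assume b: "b \<noteq> 0"
  define t where "t = b / (\<bar>c\<bar> + 1)"
  define d where "d = \<bar>c\<bar> + 1"
  have "d > 0" by (simp add: d_def)
  then have "t * b + t\<^sup>2 * c = b\<^sup>2 / d\<^sup>2 * (d + c)"
    by (simp add: t_def d_def[symmetric] power2_eq_square divide_simps) (simp add: algebra_simps)
  moreover have "d + c > 0" unfolding d_def by linarith
  ultimately have "t * b + t\<^sup>2 * c > 0"
    using b \<open>d > 0\<close> by simp
  with assms[of t] show False by linarith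
qed

definition self_adjoint :: "('v::real_inner \<Rightarrow> 'v) \<Rightarrow> bool" where
  "self_adjoint a \<longleftrightarrow> (\<forall>u v. a u \<bullet> v = u \<bullet> a v)"

text \<open>A maximiser of the Rayleigh quotient on the unit sphere of \<open>W\<close> is an
  eigenvector: the first variation vanishes in every direction of \<open>W\<close>, and the residual
  \<open>a v - l *\<^sub>R v\<close> is itself such a direction.\<close>

lemma self_adjoint_eigenvector_in_subspace:
  fixes a :: "'v::euclidean_space \<Rightarrow> 'v"
  assumes lin: "linear a" and sa: "self_adjoint a"
    and W: "subspace W" "a ` W \<subseteq> W" "W \<noteq> {0}"
  obtains v l where "v \<in> W" "norm v = 1" "a v = l *\<^sub>R v"
proof -
  interpret a: linear a by fact
  let ?K = "W \<inter> sphere 0 1"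
  have "compact ?K" using W(1) by (intro closed_Int_compact closed_subspace compact_sphere)
  moreover have "?K \<noteq> {}"
  proof -
    obtain w where "w \<in> W" "w \<noteq> 0" using W subspace_0 by blast
    then have "w /\<^sub>R norm w \<in> ?K" using W(1) by (simp add: subspace_scale)
    then show ?thesis by blast
  qed
  moreover have "continuous_on ?K (\<lambda>v. a v \<bullet> v)"
    using lin by (intro continuous_intros linear_continuous_on) (simp add: linear_conv_bounded_linear)
  ultimately obtain v where v: "v \<in> ?K" and max: "\<And>u. u \<in> ?K \<Longrightarrow> a u \<bullet> u \<le> a v \<bullet> v"
    using continuous_attains_sup[of ?K "\<lambda>v. a v \<bullet> v"] by blast
  define l where "l = a v \<bullet> v"
  have vv: "v \<bullet> v = 1" using v by (simp add: dot_square_norm)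
  have le: "a u \<bullet> u \<le> l * (u \<bullet> u)" if "u \<in> W" for u
  proof (cases "u = 0")
    case False
    have "u /\<^sub>R norm u \<in> ?K" using that W(1) False by (simp add: subspace_scale)
    from max[OF this] have "(a u \<bullet> u) / (norm u * norm u) \<le> l"
      by (simp add: l_def[symmetric] a.scaleR divide_inverse mult_ac)
    then show ?thesis using False by (simp add: divide_le_eq dot_square_norm power2_eq_square)
  qed (simp add: a.zero)
  have "(a v - l *\<^sub>R v) \<bullet> w = 0" if w: "w \<in> W" for w
  proof -
    \<comment> \<open>This is \<open>le\<close> at \<open>v + t *\<^sub>R w\<close>; the constant
      terms cancel because equality holds at \<open>v\<close>.\<close>
    have "t * (2 * ((a v - l *\<^sub>R v) \<bullet> w)) + t\<^sup>2 * (a w \<bullet> w - l * (w \<bullet> w)) \<le> 0" for t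
    proof -
      have "v + t *\<^sub>R w \<in> W" using v w W(1) by (simp add: subspace_add subspace_scale)
      from le[OF this]
      have "a v \<bullet> v + t * (a v \<bullet> w) + t * (a w \<bullet> v) + t\<^sup>2 * (a w \<bullet> w)
          \<le> l * (v \<bullet> v + 2 * t * (v \<bullet> w) + t\<^sup>2 * (w \<bullet> w))"
        by (simp add: a.add a.scaleR inner_add_left inner_add_right power2_eq_square
            inner_commute[of w v] algebra_simps)
      moreover have "a w \<bullet> v = a v \<bullet> w" using sa by (metis self_adjoint_def inner_commute)
      ultimately show ?thesis using vv by (simp add: l_def[symmetric] inner_diff_left algebra_simps)
    qed
    from quadratic_nonpos_imp_linear_coeff_zero[OF this] show ?thesis by simp
  qed
  moreover have "a v - l *\<^sub>R v \<in> W" using v W by (auto intro: subspace_diff subspace_scale)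
  ultimately have "a v = l *\<^sub>R v" using inner_eq_zero_iff eq_iff_diff_eq_0 by blast
  with v that show ?thesis by auto
qed

text \<open>A largest orthonormal set of eigenvectors spans, since its orthogonal complement is
  invariant under \<open>a\<close> and, if nonzero, would contain a further eigenvector.\<close>

theorem self_adjoint_eigenbasis:
  fixes a :: "'v::euclidean_space \<Rightarrow> 'v"
  assumes lin: "linear a" and sa: "self_adjoint a"
  obtains B :: "'v set" and l where "finite B" "pairwise orthogonal B" "\<And>b. b \<in> B \<Longrightarrow> norm b = 1"
    "span B = UNIV" "\<And>b. b \<in> B \<Longrightarrow> a b = l b *\<^sub>R b"
proof -
  interpret a: linear a by fact
  define P where "P B \<longleftrightarrow> pairwise orthogonal B \<and> (\<forall>b\<in>B. norm b = 1 \<and> (\<exists>l. a b = l *\<^sub>R b))" for B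
  have bound: "finite B \<and> card B \<le> DIM('v)" if "P B" for B
    using that unfolding P_def
    by (intro independent_bound pairwise_orthogonal_independent) auto
  have "P {}" by (simp add: P_def)
  then obtain B where B: "P B" and max: "\<And>B'. P B' \<Longrightarrow> card B' \<le> card B"
    using ex_has_greatest_nat[of P "{}" card "Suc DIM('v)"] bound by (auto simp: less_Suc_eq_le)
  have "span B = UNIV"
  proof (rule ccontr)
    assume "span B \<noteq> UNIV"
    then obtain w where w: "w \<noteq> 0" "\<forall>x\<in>span B. w \<bullet> x = 0" using span_not_UNIV_orthogonal by blast
    define W where "W = {w. \<forall>b\<in>B. w \<bullet> b = 0}"
    have "subspace W" by (auto simp: W_def subspace_def inner_simps)
    moreover have "a ` W \<subseteq> W"
    proof clarify
      fix w assume w: "w \<in> W"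
      show "a w \<in> W" unfolding W_def
      proof clarify
        fix b assume "b \<in> B"
        then obtain l where "a b = l *\<^sub>R b" using B P_def by blast
        then show "a w \<bullet> b = 0" using w sa \<open>b \<in> B\<close> by (simp add: self_adjoint_def W_def)
      qed
    qed
    moreover have "w \<in> W" using w span_base by (auto simp: W_def)
    ultimately obtain v l where v: "v \<in> W" "norm v = 1" "a v = l *\<^sub>R v"
      using self_adjoint_eigenvector_in_subspace[OF lin sa] w by (metis singletonD)
    have "v \<notin> B" using v by (auto simp: W_def)
    have "P (insert v B)" using B v
      by (auto simp: P_def pairwise_insert orthogonal_def W_def inner_commute)
    from max[OF this] bound[OF B] \<open>v \<notin> B\<close> show False by simp
  qed
  moreover obtain l where "\<And>b. b \<in> B \<Longrightarrow> a b = l b *\<^sub>R b" using B unfolding P_def by metis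
  ultimately show ?thesis using that[of B l] B bound[OF B] by (auto simp: P_def)
qed

section \<open>Square roots of positive self-adjoint maps\<close>

definition positive_form :: "('v::real_inner \<Rightarrow> 'v) \<Rightarrow> bool" where
  "positive_form a \<longleftrightarrow> (\<forall>v. v \<noteq> 0 \<longrightarrow> a v \<bullet> v > 0)"

text \<open>The root multiplies each vector of an eigenbasis by the square root of its eigenvalue.
  The last conclusion speaks of all eigenvectors, not only of those in the chosen basis;
  intertwining arguments rest on it.\<close>

lemma sqrt_exists:
  fixes a :: "'v::euclidean_space \<Rightarrow> 'v"
  assumes lin: "linear a" and sa: "self_adjoint a" and pos: "positive_form a"
  obtains s where "linear s" "self_adjoint s" "positive_form s" "\<And>v. s (s v) = a v"
    "\<And>v l. a v = l *\<^sub>R v \<Longrightarrow> s v = sqrt l *\<^sub>R v"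
proof -
  interpret a: linear a by fact
  obtain B :: "'v set" and l where B: "finite B" "pairwise orthogonal B" "\<And>b. b \<in> B \<Longrightarrow> norm b = 1"
    "span B = UNIV" "\<And>b. b \<in> B \<Longrightarrow> a b = l b *\<^sub>R b"
    using self_adjoint_eigenbasis[OF lin sa] by metis
  define s where "s v = (\<Sum>b\<in>B. (sqrt (l b) * (v \<bullet> b)) *\<^sub>R b)" for v
  have "linear s"
    by (rule linearI) (simp_all add: s_def inner_simps algebra_simps sum.distrib scaleR_sum_right)
  moreover have "self_adjoint s"
    by (auto simp: self_adjoint_def s_def inner_sum_left inner_sum_right inner_commute mult_ac)
  \<comment> \<open>By self-adjointness \<open>v\<close> is orthogonal to every basis vector whose
    eigenvalue differs from \<open>k\<close>, so \<open>sqrt (l b)\<close> may be replaced by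
    \<open>sqrt k\<close> in each term.\<close>
  moreover have eig: "s v = sqrt k *\<^sub>R v" if v: "a v = k *\<^sub>R v" for v k
  proof -
    have "(sqrt (l b) * (v \<bullet> b)) *\<^sub>R b = sqrt k *\<^sub>R ((v \<bullet> b) *\<^sub>R b)" if b: "b \<in> B" for b
    proof (cases "v \<bullet> b = 0")
      case False
      have "k * (v \<bullet> b) = l b * (v \<bullet> b)" using sa v B(5)[OF b] unfolding self_adjoint_def
        by (metis inner_scaleR_left inner_scaleR_right)
      then show ?thesis using False by simp
    qed simp
    then have "s v = sqrt k *\<^sub>R (\<Sum>b\<in>B. (v \<bullet> b) *\<^sub>R b)"
      unfolding s_def scaleR_sum_right by (rule sum.cong[OF refl])
    also have "(\<Sum>b\<in>B. (v \<bullet> b) *\<^sub>R b) = v"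
    proof -
      have "(v - (\<Sum>b\<in>B. (v \<bullet> b) *\<^sub>R b)) \<bullet> c = 0" if c: "c \<in> B" for c
      proof -
        have "(\<Sum>b\<in>B. (v \<bullet> b) * (b \<bullet> c)) = (\<Sum>b\<in>B. if b = c then v \<bullet> c else 0)"
          using B(2,3) c by (intro sum.cong) (auto simp: pairwise_def orthogonal_def dot_square_norm)
        then show ?thesis using B(1) c by (simp add: inner_simps inner_sum_left)
      qed
      then have "orthogonal (v - (\<Sum>b\<in>B. (v \<bullet> b) *\<^sub>R b)) x" if "x \<in> span B" for x
        using that by (intro orthogonal_to_span[of x B]) (auto simp: orthogonal_def)
      then show ?thesis using B(4) by (metis UNIV_I eq_iff_diff_eq_0 orthogonal_self)
    qed
    finally show ?thesis .
  qed
  moreover have lpos: "l b > 0" if "b \<in> B" for b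
  proof -
    have "b \<noteq> 0" using B(3)[OF that] by auto
    then have "a b \<bullet> b > 0" using pos by (simp add: positive_form_def)
    then show ?thesis using B(3)[OF that] by (simp add: B(5)[OF that] dot_square_norm)
  qed
  moreover have "positive_form s" unfolding positive_form_def
  proof (intro allI impI)
    fix v :: 'v assume "v \<noteq> 0"
    have "\<exists>b\<in>B. v \<bullet> b \<noteq> 0"
    proof (rule ccontr)
      assume "\<not> (\<exists>b\<in>B. v \<bullet> b \<noteq> 0)"
      then have "orthogonal v x" if "x \<in> span B" for x
        using that by (intro orthogonal_to_span[of x B]) (auto simp: orthogonal_def)
      then show False using B(4) \<open>v \<noteq> 0\<close> by (metis UNIV_I orthogonal_self)
    qed
    then obtain b where b: "b \<in> B" "v \<bullet> b \<noteq> 0" by blast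
    have "s v \<bullet> v = (\<Sum>b\<in>B. sqrt (l b) * (v \<bullet> b)\<^sup>2)"
      unfolding inner_commute[of "s v"]
      by (simp add: s_def inner_sum_right power2_eq_square mult.assoc)
    also have "\<dots> > 0" using B(1) b lpos
      by (intro sum_pos2[of B b]) (auto intro!: mult_nonneg_nonneg less_imp_le[OF lpos])
    finally show "s v \<bullet> v > 0" .
  qed
  moreover have "s (s v) = a v" for v
  proof -
    have "linear (s \<circ> s)" using \<open>linear s\<close> by (intro linear_compose)
    moreover have "(s \<circ> s) b = a b" if "b \<in> B" for b
      using eig[OF B(5)[OF that]] lpos[OF that] linear_scale[OF \<open>linear s\<close>, of _ b] B(5)[OF that] by simp
    ultimately have "(s \<circ> s) v = a v"
      using linear_eq_on_span[of "s \<circ> s" a B v] lin B(4) by blast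
    then show ?thesis by simp
  qed
  ultimately show ?thesis using that by blast
qed

text \<open>A map carrying \<open>a\<close> to \<open>a'\<close> maps eigenvectors to eigenvectors with the same eigenvalue.\<close>

lemma sqrt_intertwine:
  fixes a s :: "'v::euclidean_space \<Rightarrow> 'v"
  assumes "linear a" "self_adjoint a" "linear s" "linear s'" "linear T"
    and s: "\<And>v l. a v = l *\<^sub>R v \<Longrightarrow> s v = sqrt l *\<^sub>R v"
    and s': "\<And>v l. a' v = l *\<^sub>R v \<Longrightarrow> s' v = sqrt l *\<^sub>R v"
    and T: "\<And>v. T (a v) = a' (T v)"
  shows "T (s v) = s' (T v)"
proof -
  obtain B :: "'v set" and l where B: "span B = UNIV" "\<And>b. b \<in> B \<Longrightarrow> a b = l b *\<^sub>R b"
    using self_adjoint_eigenbasis[OF assms(1,2)] by metis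
  have "(T \<circ> s) b = (s' \<circ> T) b" if "b \<in> B" for b
  proof -
    have "a' (T b) = l b *\<^sub>R T b" using T[of b] B(2)[OF that] linear_scale[OF \<open>linear T\<close>] by simp
    from s'[OF this] s[OF B(2)[OF that]] show ?thesis
      using linear_scale[OF \<open>linear T\<close>] by simp
  qed
  moreover have "linear (T \<circ> s)" "linear (s' \<circ> T)" using assms by (auto intro: linear_compose)
  ultimately have "(T \<circ> s) v = (s' \<circ> T) v" using B(1) linear_eq_on_span[of "T \<circ> s" "s' \<circ> T" B v] by blast
  then show ?thesis by simp
qed

section \<open>Polar decompositions in the complex orthogonal group\<close>

definition cnjv :: "complex^'n \<Rightarrow> complex^'n" where
  "cnjv v = (\<chi> i. cnj (v $ i))"

definition cnjm :: "complex^'n^'m \<Rightarrow> complex^'n^'m" where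
  "cnjm A = (\<chi> i j. cnj (A $ i $ j))"

definition adj :: "complex^'n^'m \<Rightarrow> complex^'m^'n" where
  "adj A = transpose (cnjm A)"

lemma cnjv_cnjv [simp]: "cnjv (cnjv v) = v"
  by (simp add: cnjv_def vec_eq_iff)

lemma cnjv_mult_vec: "cnjv (A *v v) = cnjm A *v cnjv v"
  by (simp add: cnjv_def cnjm_def matrix_vector_mult_def vec_eq_iff)

lemma cnjv_add: "cnjv (u + v) = cnjv u + cnjv v"
  by (simp add: cnjv_def vec_eq_iff)

lemma linear_cnjv: "linear cnjv"
  by (rule linearI) (simp_all add: cnjv_def vec_eq_iff)

lemma cnjv_inner_cnjv: "cnjv u \<bullet> cnjv v = u \<bullet> v"
  by (simp add: cnjv_def inner_vec_def inner_complex_def)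

lemma cnjm_cnjm [simp]: "cnjm (cnjm A) = A"
  by (simp add: cnjm_def vec_eq_iff)

lemma cnjm_mat_1 [simp]: "cnjm (mat 1 :: complex^'n^'n) = mat 1"
  by (auto simp: cnjm_def mat_def vec_eq_iff)

lemma cnjm_mult: "cnjm (A ** B) = cnjm A ** cnjm B"
  by (simp add: cnjm_def matrix_matrix_mult_def vec_eq_iff)

lemma cnjm_transpose: "cnjm (transpose A) = transpose (cnjm A)"
  by (simp add: cnjm_def transpose_def vec_eq_iff)

lemma adj_mult: "adj (A ** B) = adj B ** adj A"
  by (simp add: adj_def cnjm_mult matrix_transpose_mul)

lemma adj_adj [simp]: "adj (adj A) = A"
  by (simp add: adj_def cnjm_transpose)

lemma inner_complex_vec: "u \<bullet> v = Re (\<Sum>i\<in>UNIV. u $ i * cnj (v $ i))" for u v :: "complex^'n"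
  by (simp add: inner_vec_def inner_complex_def)

lemma inner_adj: "(A *v u) \<bullet> v = u \<bullet> (adj A *v v)" for A :: "complex^'n^'m"
proof -
  have "(\<Sum>i\<in>UNIV. (A *v u) $ i * cnj (v $ i)) = (\<Sum>i\<in>UNIV. \<Sum>j\<in>UNIV. A $ i $ j * u $ j * cnj (v $ i))"
    by (simp add: matrix_vector_mult_def sum_distrib_right)
  also have "\<dots> = (\<Sum>j\<in>UNIV. \<Sum>i\<in>UNIV. A $ i $ j * u $ j * cnj (v $ i))"
    by (rule sum.swap)
  also have "\<dots> = (\<Sum>j\<in>UNIV. u $ j * cnj ((adj A *v v) $ j))"
    by (simp add: matrix_vector_mult_def adj_def cnjm_def transpose_def sum_distrib_left mult_ac)
  finally show ?thesis by (simp add: inner_complex_vec)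
qed

text \<open>Positive definite hermitian matrices. Both conditions refer to the real inner product,
  which is the real part of the hermitian one, so that the real spectral theorem applies.\<close>

definition hpos :: "complex^'n^'n \<Rightarrow> bool" where
  "hpos A \<longleftrightarrow> self_adjoint ((*v) A) \<and> positive_form ((*v) A)"

lemma self_adjoint_matrix_iff: "self_adjoint ((*v) A) \<longleftrightarrow> adj A = A" for A :: "complex^'n^'n"
proof
  assume "self_adjoint ((*v) A)"
  then have "u \<bullet> (adj A *v v - A *v v) = 0" for u v
    by (simp add: self_adjoint_def inner_adj[symmetric] inner_diff_right)
  then show "adj A = A" by (metis eq_iff_diff_eq_0 inner_eq_zero_iff matrix_eq)
qed (simp add: self_adjoint_def inner_adj)

lemma hpos_adj: "hpos A \<Longrightarrow> adj A = A"
  by (simp add: hpos_def self_adjoint_matrix_iff)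

lemma hpos_cnjm: "hpos A \<Longrightarrow> cnjm A = transpose A"
  by (metis adj_def hpos_adj transpose_transpose)

text \<open>The transpose of a hermitian matrix is its complex conjugate, hence acts as
  \<open>A\<close> conjugated by the isometry \<open>cnjv\<close>.\<close>

lemma hpos_transpose:
  fixes A :: "complex^'n^'n"
  assumes "hpos A"
  shows "hpos (transpose A)"
proof -
  have A: "(transpose A *v u) \<bullet> v = (A *v cnjv u) \<bullet> cnjv v" for u v
  proof -
    have "transpose A *v u = cnjv (A *v cnjv u)" using assms by (simp add: cnjv_mult_vec hpos_cnjm)
    then show ?thesis using cnjv_inner_cnjv[of "A *v cnjv u" "cnjv v"] by simp
  qed
  have "adj (transpose A) = transpose A"
    using assms by (metis adj_def cnjm_transpose hpos_adj)
  moreover have "positive_form ((*v) (transpose A))"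
    unfolding positive_form_def A
  proof (intro allI impI)
    fix v :: "complex^'n" assume "v \<noteq> 0"
    moreover have "cnjv 0 = 0" by (simp add: cnjv_def vec_eq_iff)
    ultimately have "cnjv v \<noteq> 0" by (metis cnjv_cnjv)
    then show "(A *v cnjv v) \<bullet> cnjv v > 0" using assms by (simp add: hpos_def positive_form_def)
  qed
  ultimately show ?thesis by (simp add: hpos_def self_adjoint_matrix_iff)
qed

lemma hpos_mat_1: "hpos (mat 1 :: complex^'n^'n)"
  by (simp add: hpos_def self_adjoint_def positive_form_def)

text \<open>Over the complex numbers \<open>orthogonal_matrix\<close> refers to the plain transpose,
  so this is O(n,C) and not the unitary group. The forms with a prefix \<open>X\<close> cancel
  inside products nested to the left.\<close>

lemma orthogonal_matrix_cancel:
  assumes "orthogonal_matrix A"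
  shows "A ** transpose A = mat 1" "transpose A ** A = mat 1"
    "X ** A ** transpose A = X" "X ** transpose A ** A = X"
  using assms unfolding orthogonal_matrix_def
  by (simp_all flip: matrix_mul_assoc)

lemma orthogonal_matrix_product:
  fixes A B :: "'a::comm_semiring_1^'n^'n"
  assumes "orthogonal_matrix A" "orthogonal_matrix B"
  shows "orthogonal_matrix (A ** B)"
  unfolding orthogonal_matrix_def
  by (simp add: matrix_transpose_mul matrix_mul_assoc orthogonal_matrix_cancel assms)

lemma orthogonal_matrix_cnjm:
  assumes "orthogonal_matrix A"
  shows "orthogonal_matrix (cnjm A)"
  using assms unfolding orthogonal_matrix_def
  by (metis cnjm_mat_1 cnjm_mult cnjm_transpose)

lemma orthogonal_matrix_adj:
  assumes "orthogonal_matrix A"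
  shows "orthogonal_matrix (adj A)"
  by (simp add: adj_def assms orthogonal_matrix_cnjm)

text \<open>The quadratic form of the product at \<open>v\<close> is that of \<open>A\<close> at
  \<open>g *v v\<close>, and \<open>g\<close> is invertible.\<close>

lemma hpos_conjugate:
  assumes "hpos A" "orthogonal_matrix g"
  shows "hpos (adj g ** A ** g)"
proof -
  have "adj (adj g ** A ** g) = adj g ** A ** g"
    using assms(1) by (simp add: adj_mult hpos_adj matrix_mul_assoc)
  moreover have "((adj g ** A ** g) *v v) \<bullet> v > 0" if "v \<noteq> 0" for v
  proof -
    have "((adj g ** A ** g) *v v) \<bullet> v = (A *v (g *v v)) \<bullet> (g *v v)"
      by (simp add: inner_adj flip: matrix_vector_mul_assoc)
    moreover have "g *v v \<noteq> 0"
      using assms(2) that unfolding orthogonal_matrix_def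
      by (metis matrix_vector_mul_assoc matrix_vector_mul_lid matrix_vector_mult_0_right)
    ultimately show ?thesis using assms(1) by (simp add: hpos_def positive_form_def)
  qed
  ultimately show ?thesis by (simp add: hpos_def self_adjoint_matrix_iff positive_form_def)
qed

lemma hpos_gram:
  assumes "orthogonal_matrix g"
  shows "hpos (adj g ** g)"
  using hpos_conjugate[OF hpos_mat_1 assms] by simp

text \<open>The clause on eigenvectors records which root is meant in the form used by
  \<open>sqrt_intertwine\<close>; the eigenvalue \<open>l\<close> is real, as it always is for
  \<open>hpos A\<close>.\<close>

definition is_root :: "complex^'n^'n \<Rightarrow> complex^'n^'n \<Rightarrow> bool" where
  "is_root A R \<longleftrightarrow> hpos R \<and> R ** R = A \<and>
     (\<forall>v l. A *v v = l *\<^sub>R v \<longrightarrow> R *v v = sqrt l *\<^sub>R v)"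

text \<open>The root of the underlying real-linear map is complex linear: multiplication by
  \<open>\<i>\<close> commutes with \<open>A\<close>, hence by \<open>sqrt_intertwine\<close> with
  the root, which therefore comes from a matrix.\<close>

lemma is_root_exists:
  fixes A :: "complex^'n^'n"
  assumes "hpos A"
  obtains R where "is_root A R"
proof -
  have lin: "linear ((*v) A)" by simp
  obtain s where s: "linear s" "self_adjoint s" "positive_form s" "\<And>v. s (s v) = A *v v"
    "\<And>v l. A *v v = l *\<^sub>R v \<Longrightarrow> s v = sqrt l *\<^sub>R v"
    using sqrt_exists[OF lin] assms unfolding hpos_def by blast
  have lini: "linear (\<lambda>v::complex^'n. \<i> *s v)"
    by (rule linearI) (simp_all add: vec_eq_iff algebra_simps)
  have i: "s (\<i> *s v) = \<i> *s s v" for v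
  proof -
    have *: "\<i> *s (A *v v) = A *v (\<i> *s v)" for v by (simp add: vector_scalar_commute)
    have "self_adjoint ((*v) A)" using assms by (simp add: hpos_def)
    from sqrt_intertwine[OF lin this s(1) s(1) lini s(5) s(5) *] show ?thesis by simp
  qed
  have "s (c *s v) = c *s s v" for c v
  proof -
    have *: "c *s w = Re c *\<^sub>R w + Im c *\<^sub>R (\<i> *s w)" for w :: "complex^'n"
      by (simp add: vec_eq_iff complex_eq_iff)
    show ?thesis
      unfolding *[of v] *[of "s v"]
      by (simp add: linear_add[OF s(1)] linear_scale[OF s(1)] i)
  qed
  then have "Vector_Spaces.linear (*s) (*s) s"
    by (simp add: Vector_Spaces.linear_iff vec.vector_space_axioms linear_add[OF s(1)])
  from matrix_works[OF this] have m: "(*v) (matrix s) = s" by auto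
  have "matrix s ** matrix s = A"
    by (simp add: matrix_eq m s(4) flip: matrix_vector_mul_assoc)
  then have "is_root A (matrix s)"
    using s(2,3,5) unfolding is_root_def hpos_def m by blast
  then show ?thesis using that by blast
qed

text \<open>An eigenvector of the inverse \<open>A'\<close> for \<open>l\<close> is one of
  \<open>A\<close> for \<open>1 / l\<close>, so the inverse of the root acts on it as the root of
  the inverse should.\<close>

lemma is_root_inverse:
  assumes R: "is_root A R" and A': "A' ** A = mat 1" "R' ** R = mat 1"
    and v: "A' *v v = l *\<^sub>R v"
  shows "R' *v v = sqrt l *\<^sub>R v"
proof (cases "v = 0")
  case False
  have "A ** A' = mat 1" using A' matrix_left_right_inverse by blast
  then have "v = A *v (A' *v v)" by (simp add: matrix_vector_mul_assoc)
  then have vA: "v = l *\<^sub>R (A *v v)" by (simp add: v linear_scale)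
  then have "l \<noteq> 0" using False by auto
  then have "A *v v = (1 / l) *\<^sub>R v" by (subst (2) vA) simp
  then have "R *v v = sqrt (1 / l) *\<^sub>R v" using R by (simp add: is_root_def)
  then have "R' *v (R *v v) = sqrt (1 / l) *\<^sub>R (R' *v v)" by (simp add: linear_scale)
  then have "v = sqrt (1 / l) *\<^sub>R (R' *v v)" by (simp add: matrix_vector_mul_assoc A')
  then have "sqrt l *\<^sub>R v = (sqrt l * sqrt (1 / l)) *\<^sub>R (R' *v v)" by (metis scaleR_scaleR)
  also have "sqrt l * sqrt (1 / l) = 1" using \<open>l \<noteq> 0\<close> by (simp flip: real_sqrt_mult)
  finally show ?thesis by simp
qed simp

lemma is_root_eigenvector: "is_root A R \<Longrightarrow> A *v v = l *\<^sub>R v \<Longrightarrow> R *v v = sqrt l *\<^sub>R v"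
  by (simp add: is_root_def)

lemma is_root_commute:
  assumes A: "hpos A" "is_root A R" and T: "T ** A = A ** T"
  shows "T ** R = R ** T"
proof -
  have "self_adjoint ((*v) A)" using A by (simp add: hpos_def)
  moreover have "T *v (A *v v) = A *v (T *v v)" for v
    using T by (simp add: matrix_vector_mul_assoc)
  ultimately have "T *v (R *v v) = R *v (T *v v)" for v
    using sqrt_intertwine[of "(*v) A" "(*v) R" "(*v) R" "(*v) T" "(*v) A" v]
      is_root_eigenvector[OF A(2)] by blast
  then show ?thesis by (simp add: matrix_eq flip: matrix_vector_mul_assoc)
qed

lemma is_root_intertwine_inverse:
  assumes A: "hpos A" "is_root A R" and inv: "A' ** A = mat 1" "R' ** R = mat 1"
    and T: "linear T" "\<And>v. T (A *v v) = A' *v T v"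
  shows "T (R *v v) = R' *v T v"
proof -
  have "self_adjoint ((*v) A)" using A by (simp add: hpos_def)
  then show ?thesis
    by (rule sqrt_intertwine[OF matrix_vector_mul_linear _ matrix_vector_mul_linear
        matrix_vector_mul_linear T(1) is_root_eigenvector[OF A(2)] is_root_inverse[OF A(2) inv] T(2)])
qed

text \<open>Complex conjugation turns \<open>A\<close> into its transpose, which is its inverse, and
  so turns \<open>R\<close> into the inverse of \<open>R\<close>. As \<open>R\<close> is hermitian,
  its conjugate is also its transpose.\<close>

lemma is_root_orthogonal:
  assumes A: "hpos A" "orthogonal_matrix A" "is_root A R"
  shows "orthogonal_matrix R"
proof -
  have RR: "R ** R = A" using A by (simp add: is_root_def)
  have "R ** (R ** transpose A) = mat 1"
    using A RR by (simp add: matrix_mul_assoc orthogonal_matrix_cancel)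
  \<comment> \<open>\<open>R ** transpose A\<close> is the inverse of \<open>R\<close>, because
    \<open>R ** R = A\<close>.\<close>
  then have inv: "(R ** transpose A) ** R = mat 1" using matrix_left_right_inverse by blast
  have "transpose A ** A = mat 1" using A(2) by (rule orthogonal_matrix_cancel)
  moreover have "cnjv (A *v v) = transpose A *v cnjv v" for v
    using A(1) by (simp add: cnjv_mult_vec hpos_cnjm)
  ultimately have "cnjv (R *v v) = (R ** transpose A) *v cnjv v" for v
    using is_root_intertwine_inverse[OF A(1,3) _ inv linear_cnjv] by blast
  then have "cnjm R *v cnjv v = (R ** transpose A) *v cnjv v" for v by (simp add: cnjv_mult_vec)
  then have "cnjm R = R ** transpose A" by (metis cnjv_cnjv matrix_eq)
  moreover have "cnjm R = transpose R" using A by (simp add: is_root_def hpos_cnjm)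
  ultimately have "transpose R ** R = mat 1" using inv by simp
  then show ?thesis using matrix_left_right_inverse unfolding orthogonal_matrix_def by blast
qed

text \<open>\<open>F\<close> plays the role of the stabiliser of the tensor \<open>x\<close>, and \<open>th\<close> that of the matrix of the
  composition of the two conjugations. The last membership in \<open>F\<close> says \<open>s x = k h x\<close>.\<close>

lemma conjugate_real_element_exists:
  fixes th h :: "complex^'n^'n"
  assumes th: "orthogonal_matrix th" "cnjm th = th" "th ** th = mat 1" and h: "orthogonal_matrix h"
    and F_mult: "\<And>f g. f \<in> F \<Longrightarrow> g \<in> F \<Longrightarrow> f ** g \<in> F"
    and F_inv: "\<And>f. f \<in> F \<Longrightarrow> transpose f \<in> F"
    and F_root: "\<And>r g. hpos r \<Longrightarrow> orthogonal_matrix r \<Longrightarrow> orthogonal_matrix g \<Longrightarrow>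
      transpose g ** r ** r ** g \<in> F \<Longrightarrow> transpose g ** r ** g \<in> F"
    and F: "transpose (adj h ** h) ** th \<in> F"
  obtains s k where "orthogonal_matrix s" "orthogonal_matrix k" "th ** cnjm s = s ** th" "cnjm k = k"
    "transpose h ** transpose k ** s \<in> F"
proof -
  have th_T: "transpose th = th" by (metis matrix_mul_assoc matrix_mul_lid matrix_mul_rid
        orthogonal_matrix_cancel(2) th(1,3))
  have th_c: "X ** th ** th = X" for X by (metis matrix_mul_assoc matrix_mul_rid th(3))
  define a where "a = adj h ** h"
  have a: "hpos a" "orthogonal_matrix a"
    using h by (auto simp: a_def hpos_gram orthogonal_matrix_product orthogonal_matrix_adj)
  obtain al where al_root: "is_root a al" using is_root_exists[OF a(1)] .
  then have al: "hpos al" "orthogonal_matrix al" "al ** al = a"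
    using is_root_orthogonal[OF a] by (auto simp: is_root_def)
  \<comment> \<open>\<open>th ** a\<close> is similar to the hermitian matrix \<open>n\<close>,
    namely \<open>th ** a = transpose al ** n ** al\<close>.\<close>
  define n where "n = al ** th ** al"
  have n: "orthogonal_matrix n" using al th by (simp add: n_def orthogonal_matrix_product)
  have "adj n = n" using al th th_T by (simp add: n_def adj_mult hpos_adj matrix_mul_assoc adj_def[of th])
  \<comment> \<open>\<open>n\<close> need not be positive, but its square is; the root
    \<open>mu\<close> of \<open>m\<close> is the absolute value of \<open>n\<close> and commutes
    with \<open>n\<close>.\<close>
  define m where "m = n ** n"
  have m: "hpos m" "orthogonal_matrix m"
    using hpos_gram[OF n] n \<open>adj n = n\<close> by (auto simp: m_def orthogonal_matrix_product)
  obtain mu where mu_root: "is_root m mu" using is_root_exists[OF m(1)] .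
  then have mu: "hpos mu" "orthogonal_matrix mu" "mu ** mu = m"
    using is_root_orthogonal[OF m] by (auto simp: is_root_def)
  have comm: "n ** mu = mu ** n"
    using is_root_commute[OF m(1) mu_root, of n] by (simp add: m_def matrix_mul_assoc)

  have "transpose (transpose a ** th) \<in> F" using F_inv[OF F] unfolding a_def .
  then have "th ** a \<in> F" unfolding matrix_transpose_mul th_T transpose_transpose .
  \<comment> \<open>Squaring replaces \<open>n\<close> by \<open>n ** n = mu ** mu\<close>, to which
    \<open>F_root\<close> applies.\<close>
  then have "(th ** a) ** (th ** a) \<in> F" using F_mult by blast
  also have "(th ** a) ** (th ** a) = transpose al ** mu ** mu ** al"
  proof -
    have "transpose al ** mu ** mu ** al = transpose al ** n ** n ** al"
      using mu(3) by (simp add: m_def flip: matrix_mul_assoc)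
    then show ?thesis
      by (simp add: n_def matrix_mul_assoc orthogonal_matrix_cancel[OF al(2)] flip: al(3))
  qed
  finally have "transpose (transpose al ** mu ** al) \<in> F"
    using F_root mu al F_inv by blast
  then have F1: "transpose al ** transpose mu ** al \<in> F"
    by (simp add: matrix_transpose_mul matrix_mul_assoc)

  \<comment> \<open>the geometric mean of \<open>a\<close> and the inverse of \<open>th ** a ** th\<close>\<close>
  define c where "c = al ** transpose mu ** al"
  have c: "hpos c" "orthogonal_matrix c"
    using hpos_conjugate[OF hpos_transpose[OF mu(1)] al(2)] al mu
    by (auto simp: c_def hpos_adj orthogonal_matrix_product)
  \<comment> \<open>\<open>transpose a ** c\<close> is the conjugate of \<open>transpose mu\<close>
    by \<open>al\<close> found in \<open>F1\<close>; membership in \<open>F\<close> says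
    \<open>c x = a x\<close>.\<close>
  have ac: "transpose a ** c \<in> F"
    using F1 by (simp add: c_def matrix_transpose_mul matrix_mul_assoc
        orthogonal_matrix_cancel[OF al(2)] flip: al(3))
  \<comment> \<open>Conjugation by \<open>th\<close> inverts \<open>c\<close>. The ingredients are
    \<open>th = transpose al ** n ** transpose al\<close>, the commutation of \<open>n\<close> with
    \<open>mu\<close>, and \<open>n ** n = mu ** mu\<close>.\<close>
  have thc: "th ** c = transpose c ** th"
  proof -
    have "th ** c = transpose al ** n ** transpose mu ** al"
      by (simp add: c_def n_def matrix_mul_assoc orthogonal_matrix_cancel[OF al(2)])
    also have "n ** transpose mu = transpose mu ** n"
    proof -
      have "transpose mu ** (n ** mu) ** transpose mu = transpose mu ** (mu ** n) ** transpose mu"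
        by (simp add: comm)
      then show ?thesis by (simp add: matrix_mul_assoc orthogonal_matrix_cancel[OF mu(2)])
    qed
    then have "transpose al ** n ** transpose mu ** al = transpose al ** transpose mu ** n ** al"
      by (simp flip: matrix_mul_assoc)
    also have "n ** al = n ** n ** transpose al ** th"
      by (simp add: n_def matrix_mul_assoc orthogonal_matrix_cancel[OF al(2)] th_c)
    then have "transpose al ** transpose mu ** n ** al
        = transpose al ** transpose mu ** mu ** mu ** transpose al ** th"
      using mu(3) by (simp add: m_def flip: matrix_mul_assoc)
    also have "\<dots> = transpose c ** th"
      by (simp add: c_def matrix_transpose_mul matrix_mul_assoc orthogonal_matrix_cancel[OF mu(2)])
    finally show ?thesis .
  qed

  obtain s where s_root: "is_root c s" using is_root_exists[OF c(1)] .
  then have s: "hpos s" "orthogonal_matrix s" "s ** s = c"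
    using is_root_orthogonal[OF c] by (auto simp: is_root_def)
  \<comment> \<open>Inversion by \<open>th\<close> passes from \<open>c\<close> to its root
    \<open>s\<close>.\<close>
  have "th *v (s *v v) = transpose s *v (th *v v)" for v
  proof (rule is_root_intertwine_inverse[OF c(1) s_root orthogonal_matrix_cancel(2)[OF c(2)]
        orthogonal_matrix_cancel(2)[OF s(2)] matrix_vector_mul_linear])
    show "th *v (c *v v) = transpose c *v (th *v v)" for v
      by (simp add: matrix_vector_mul_assoc thc)
  qed
  then have "th ** s = transpose s ** th" by (simp add: matrix_eq flip: matrix_vector_mul_assoc)
  then have "th ** (th ** s) ** th = th ** (transpose s ** th) ** th" by simp
  \<comment> \<open>The inverse of the hermitian orthogonal \<open>s\<close> is
    \<open>cnjm s\<close>; hence \<open>s\<close> commutes with the antilinear map sending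
    \<open>z\<close> to \<open>th *v cnjv z\<close>.\<close>
  then have ths: "th ** cnjm s = s ** th"
    using s by (simp add: hpos_cnjm matrix_mul_assoc th_c th(3))

  \<comment> \<open>Polar decomposition of \<open>u\<close>, with positive factor \<open>r\<close>
    and remaining factor \<open>k\<close> defined below.\<close>
  define u where "u = s ** transpose h"
  have u: "orthogonal_matrix u" using s h by (simp add: u_def orthogonal_matrix_product)
  define w where "w = adj u ** u"
  have w: "hpos w" "orthogonal_matrix w"
    using u by (auto simp: w_def hpos_gram orthogonal_matrix_product orthogonal_matrix_adj)
  obtain r where r_root: "is_root w r" using is_root_exists[OF w(1)] .
  then have r: "hpos r" "orthogonal_matrix r" "r ** r = w"
    using is_root_orthogonal[OF w] by (auto simp: is_root_def)
  \<comment> \<open>This conjugate of \<open>r ** r\<close> turns out to be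
    \<open>transpose a ** c\<close>, which is in \<open>F\<close>; thus \<open>r ** r\<close> fixes
    \<open>h x\<close>, and by \<open>F_root\<close> so does \<open>r\<close>.\<close>
  have "transpose h ** r ** r ** h = transpose h ** w ** h"
    using r(3) by (simp flip: matrix_mul_assoc)
  also have "\<dots> = transpose h ** cnjm h ** s ** s"
    using s(1) by (simp add: w_def u_def adj_mult hpos_adj matrix_mul_assoc
        orthogonal_matrix_cancel[OF h] adj_def[of "transpose h"] cnjm_transpose)
  also have "\<dots> = transpose a ** c"
    using s(3) by (simp add: a_def adj_def matrix_transpose_mul flip: matrix_mul_assoc)
  finally have rF: "transpose h ** r ** h \<in> F" using F_root[OF r(1,2) h] ac by simp

  define k where "k = u ** transpose r"
  have k: "orthogonal_matrix k" using u r by (simp add: k_def orthogonal_matrix_product)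
  \<comment> \<open>A matrix that is both unitary and complex orthogonal is real: its adjoint and
    its transpose are both its inverse.\<close>
  have "adj k ** k = transpose r ** w ** transpose r"
    using r(1) by (simp add: k_def w_def adj_mult matrix_mul_assoc hpos_adj[OF hpos_transpose])
  also have "\<dots> = mat 1"
    by (simp add: matrix_mul_assoc orthogonal_matrix_cancel[OF r(2)] flip: r(3))
  finally have "adj k = transpose k"
    by (metis k matrix_mul_assoc matrix_mul_lid matrix_mul_rid orthogonal_matrix_cancel(1))
  then have "cnjm k = k" by (metis adj_def transpose_transpose)
  moreover have "transpose h ** transpose k ** s = transpose h ** r ** h"
    by (simp add: k_def u_def matrix_transpose_mul matrix_mul_assoc orthogonal_matrix_cancel[OF s(2)])
  ultimately show ?thesis using that[OF s(2) k ths] rF by simp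
qed

section \<open>Stabilisers of multilinear forms\<close>

definition multilinear :: "nat \<Rightarrow> ((complex^'n) list \<Rightarrow> complex) \<Rightarrow> bool" where
  "multilinear N T \<longleftrightarrow> (\<forall>zs j u w c. length zs = N \<longrightarrow> j < N \<longrightarrow>
     T (zs[j := u + c *s w]) = T (zs[j := u]) + c * T (zs[j := w]))"

lemma multilinear_add_scale:
  "multilinear N T \<Longrightarrow> length zs = N \<Longrightarrow> j < N \<Longrightarrow>
    T (zs[j := u + c *s w]) = T (zs[j := u]) + c * T (zs[j := w])"
  by (simp add: multilinear_def)

lemma multilinear_zero:
  assumes "multilinear N T" "length zs = N" "j < N"
  shows "T (zs[j := 0]) = 0"
proof -
  have "T (zs[j := 0 + 1 *s 0]) = T (zs[j := 0]) + 1 * T (zs[j := 0])"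
    by (rule multilinear_add_scale[OF assms])
  then show ?thesis by simp
qed

lemma multilinear_scale:
  assumes "multilinear N T" "length zs = N" "j < N"
  shows "T (zs[j := c *s w]) = c * T (zs[j := w])"
  using multilinear_add_scale[OF assms, of 0 c w] multilinear_zero[OF assms] by simp

text \<open>Slots are freed one at a time: in the induction the first \<open>k\<close> entries are
  arbitrary and the others lie in \<open>B\<close>. Linearity in slot \<open>k\<close> extends
  equality from \<open>B\<close> to its span.\<close>

lemma multilinear_eq_on_spanning:
  assumes T: "multilinear N T" "multilinear N T'" and B: "vec.span B = UNIV"
    and eq: "\<And>zs. length zs = N \<Longrightarrow> set zs \<subseteq> B \<Longrightarrow> T zs = T' zs"
    and zs: "length zs = N"
  shows "T zs = T' zs"
proof -
  have "T zs = T' zs" if "k \<le> N" "length zs = N" "\<forall>i. k \<le> i \<longrightarrow> i < N \<longrightarrow> zs ! i \<in> B" for k zs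
    using that
  proof (induction k arbitrary: zs)
    case 0
    then show ?case by (intro eq) (auto simp: in_set_conv_nth)
  next
    case (Suc k)
    then have k: "k < N" "length zs = N" by auto
    have "T (zs[k := z]) = T' (zs[k := z])" if "z \<in> vec.span B" for z
      using that
    proof (induction rule: vec.span_induct_alt)
      case base
      show ?case using T k by (simp add: multilinear_zero)
    next
      case (step c x y)
      have "T (zs[k := x]) = T' (zs[k := x])"
        using Suc.prems step(1) by (intro Suc.IH) (auto simp: nth_list_update)
      then show ?case
        unfolding add.commute[of _ y] multilinear_add_scale[OF T(1) k(2,1)] multilinear_add_scale[OF T(2) k(2,1)]
        using step(2) by simp
    qed
    from this[of "zs ! k"] show ?case using B by simp
  qed
  from this[of N zs] zs show ?thesis by simp
qed

lemma multilinear_compose: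
  assumes "multilinear N T"
  shows "multilinear N (\<lambda>zs. T (map ((*v) A) zs))"
  using assms unfolding multilinear_def
  by (simp add: map_update matrix_vector_right_distrib vector_scalar_commute)

text \<open>The induction pulls the scalars out of a growing prefix of the list.\<close>

lemma multilinear_scale_all:
  assumes T: "multilinear N T" and zs: "length zs = N"
  shows "T (map (\<lambda>z. l z *s z) zs) = prod_list (map l zs) * T zs"
proof -
  have "T (map (\<lambda>z. l z *s z) (take k zs) @ drop k zs) = prod_list (map l (take k zs)) * T zs"
    if "k \<le> N" for k
    using that
  proof (induction k)
    case (Suc k)
    let ?us = "map (\<lambda>z. l z *s z) (take k zs) @ drop k zs"
    have k: "k < length zs" using Suc.prems zs by simp
    then have "map (\<lambda>z. l z *s z) (take (Suc k) zs) @ drop (Suc k) zs = ?us[k := l (zs ! k) *s zs ! k]"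
      by (simp add: take_Suc_conv_app_nth list_update_append Cons_nth_drop_Suc[symmetric])
    also have "T \<dots> = l (zs ! k) * T (?us[k := zs ! k])"
      using Suc.prems zs by (intro multilinear_scale[OF T]) auto
    also have "?us[k := zs ! k] = ?us"
      using k by (simp add: list_update_append Cons_nth_drop_Suc[symmetric])
    finally show ?case using Suc k by (simp add: take_Suc_conv_app_nth mult_ac)
  qed simp
  from this[of N] zs show ?thesis by simp
qed

text \<open>On lists of eigenvectors of \<open>R\<close>, composition with \<open>R\<close> multiplies \<open>T\<close> by a positive factor \<open>\<rho>\<close>;
  if \<open>\<rho>\<^sup>2\<close> fixes the value, so does \<open>\<rho>\<close>.\<close>

lemma multilinear_fixed_by_root:
  assumes R: "hpos R" and T: "multilinear N T"
    and fixed: "\<And>zs. length zs = N \<Longrightarrow> T (map ((*v) (R ** R)) zs) = T zs"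
    and zs: "length zs = N"
  shows "T (map ((*v) R) zs) = T zs"
proof -
  have "self_adjoint ((*v) R)" using R by (simp add: hpos_def)
  then obtain B l where B: "\<And>b. b \<in> B \<Longrightarrow> norm b = 1" "span B = UNIV"
    "\<And>b. b \<in> B \<Longrightarrow> R *v b = l b *\<^sub>R b"
    using self_adjoint_eigenbasis[OF matrix_vector_mul_linear] by metis
  have lpos: "l b > 0" if "b \<in> B" for b
  proof -
    have "b \<noteq> 0" using B(1)[OF that] by auto
    then have "(R *v b) \<bullet> b > 0" using R by (simp add: hpos_def positive_form_def)
    then show ?thesis using B(1)[OF that] by (simp add: B(3)[OF that] dot_square_norm)
  qed
  have Rb: "R *v b = of_real (l b) *s b" "(R ** R) *v b = of_real (l b * l b) *s b" if "b \<in> B" for b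
  proof -
    show 1: "R *v b = of_real (l b) *s b"
      using B(3)[OF that] by (simp add: vec_eq_iff complex_eq_iff)
    then show "(R ** R) *v b = of_real (l b * l b) *s b"
      by (simp add: vector_scalar_commute vector_smult_assoc flip: matrix_vector_mul_assoc)
  qed
  show ?thesis
  proof (rule multilinear_eq_on_spanning[OF multilinear_compose[OF T] T _ _ zs])
    \<comment> \<open>The eigenbasis spans over the reals; the complex span, being a real subspace,
      contains the real one.\<close>
    have "span B \<subseteq> vec.span B"
    proof (rule span_minimal)
      show "subspace (vec.span B)" unfolding subspace_def
      proof (intro conjI ballI allI)
        show "c *\<^sub>R x \<in> vec.span B" if "x \<in> vec.span B" for c x
        proof -
          have "c *\<^sub>R x = of_real c *s x" by (simp add: vec_eq_iff complex_eq_iff)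
          then show ?thesis using that by (simp add: vec.span_scale)
        qed
      qed (auto simp: vec.span_zero vec.span_add)
    qed (rule vec.span_superset)
    then show "vec.span B = UNIV" using B(2) by blast
  next
    fix zs :: "(complex^'a) list" assume zs: "length zs = N" "set zs \<subseteq> B"
    define \<rho> where "\<rho> = prod_list (map l zs)"
    have \<rho>: "\<rho> > 0" "prod_list (map (\<lambda>z. of_real (l z)) zs) = complex_of_real \<rho>"
      "prod_list (map (\<lambda>z. of_real (l z * l z)) zs) = complex_of_real (\<rho> * \<rho>)"
      using zs(2) unfolding \<rho>_def by (induction zs) (auto simp: lpos)
    have maps: "map ((*v) R) zs = map (\<lambda>z. of_real (l z) *s z) zs"
      "map ((*v) (R ** R)) zs = map (\<lambda>z. of_real (l z * l z) *s z) zs"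
      using zs(2) Rb by (auto intro!: map_cong)
    have 1: "T (map ((*v) R) zs) = \<rho> * T zs"
      by (simp only: maps multilinear_scale_all[OF T zs(1)] \<rho>(2))
    have "T (map ((*v) (R ** R)) zs) = complex_of_real (\<rho> * \<rho>) * T zs"
      by (simp only: maps multilinear_scale_all[OF T zs(1)] \<rho>(3))
    then have "complex_of_real (\<rho> * \<rho>) * T zs = T zs" using fixed[OF zs(1)] by simp
    then have "T zs = 0 \<or> complex_of_real (\<rho> * \<rho>) = 1" by simp
    then have "T zs = 0 \<or> \<rho> * \<rho> = 1" by (metis of_real_eq_1_iff)
    then show "T (map ((*v) R) zs) = T zs"
    proof
      assume "\<rho> * \<rho> = 1"
      then have "\<rho> = 1" using \<rho>(1) by (metis abs_of_pos abs_mult_self_eq abs_square_eq_1 power2_eq_square)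
      then show ?thesis using 1 by simp
    qed (simp add: 1)
  qed
qed

text \<open>In terms of multilinear forms the group acts by \<open>(h T) zs = T (map ((*v) (transpose h)) zs)\<close>, the
  transpose being the inverse.\<close>

theorem multilinear_real_orbits_meet:
  fixes th h :: "complex^'n^'n"
  assumes T: "\<And>N T. (N, T) \<in> I \<Longrightarrow> multilinear N T"
    and th: "orthogonal_matrix th" "cnjm th = th" "th ** th = mat 1" and h: "orthogonal_matrix h"
    and real1: "\<And>N T zs. (N, T) \<in> I \<Longrightarrow> length zs = N \<Longrightarrow> T (map (\<lambda>z. th *v cnjv z) zs) = cnj (T zs)"
    and real2: "\<And>N T zs. (N, T) \<in> I \<Longrightarrow> length zs = N \<Longrightarrow>
      T (map (\<lambda>z. transpose h *v cnjv z) zs) = cnj (T (map (\<lambda>z. transpose h *v z) zs))"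
  obtains s k where "orthogonal_matrix s" "orthogonal_matrix k" "th ** cnjm s = s ** th" "cnjm k = k"
    "\<And>N T zs. (N, T) \<in> I \<Longrightarrow> length zs = N \<Longrightarrow>
      T (map (\<lambda>z. transpose s *v z) zs) = T (map (\<lambda>z. transpose h *v (transpose k *v z)) zs)"
proof -
  \<comment> \<open>The common stabiliser of all the forms, so that a single pair \<open>s\<close>,
    \<open>k\<close> serves every summand of a tensor.\<close>
  define F where "F = {f. orthogonal_matrix f \<and>
    (\<forall>(N, T)\<in>I. \<forall>zs. length zs = N \<longrightarrow> T (map ((*v) f) zs) = T zs)}"
  have FD: "T (map ((*v) f) zs) = T zs" if "f \<in> F" "(N, T) \<in> I" "length zs = N" for f N T zs
    using that by (auto simp: F_def)
  have mm: "map ((*v) (A ** B)) zs = map ((*v) A) (map ((*v) B) zs)" for A B :: "complex^'n^'n" and zs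
    by (simp add: matrix_vector_mul_assoc)
  have m1: "map ((*v) (mat 1)) zs = zs" for zs :: "(complex^'n) list"
    by (simp add: map_idI)
  have F_mult: "f ** g \<in> F" if "f \<in> F" "g \<in> F" for f g
    unfolding F_def
  proof (clarsimp, intro conjI allI impI ballI, safe)
    show "orthogonal_matrix (f ** g)" using that by (simp add: F_def orthogonal_matrix_product)
    fix N T and zs :: "(complex^'n) list" assume N: "(length zs, T) \<in> I"
    show "T (map ((*v) (f ** g)) zs) = T zs"
      unfolding mm using FD[OF that(1) N, of "map ((*v) g) zs"] FD[OF that(2) N, of zs] by simp
  qed
  have F_inv: "transpose f \<in> F" if f: "f \<in> F" for f
    unfolding F_def
  proof (clarsimp, intro conjI allI impI ballI, safe)
    show o: "orthogonal_matrix f" using f by (simp add: F_def)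
    fix N T and zs :: "(complex^'n) list" assume N: "(length zs, T) \<in> I"
    have "T (map ((*v) f) (map ((*v) (transpose f)) zs)) = T (map ((*v) (transpose f)) zs)"
      using FD[OF f N, of "map ((*v) (transpose f)) zs"] by simp
    then show "T (map ((*v) (transpose f)) zs) = T zs"
      unfolding mm[symmetric] orthogonal_matrix_cancel[OF o] m1 by simp
  qed
  have F_root: "transpose g ** r ** g \<in> F"
    if r: "hpos r" "orthogonal_matrix r" and g: "orthogonal_matrix g"
      and F: "transpose g ** r ** r ** g \<in> F" for r g
    unfolding F_def
  proof (clarsimp, intro conjI allI impI ballI, safe)
    show "orthogonal_matrix (transpose g ** r ** g)"
      using r g by (simp add: orthogonal_matrix_product)
    fix N T and zs :: "(complex^'n) list" assume N: "(length zs, T) \<in> I"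
    \<comment> \<open>The form \<open>T\<close> moved by \<open>g\<close>: that \<open>T\<close> is
      fixed by the conjugate of \<open>r ** r\<close> means that \<open>?T\<close> is fixed by
      \<open>r ** r\<close>.\<close>
    let ?T = "\<lambda>zs. T (map ((*v) (transpose g)) zs)"
    have "?T (map ((*v) (r ** r)) us) = ?T us" if "length us = length zs" for us
    proof -
      have "T (map ((*v) (transpose g ** r ** r ** g)) (map ((*v) (transpose g)) us)) = ?T us"
        using FD[OF F N, of "map ((*v) (transpose g)) us"] that by simp
      then show ?thesis
        unfolding mm[symmetric] matrix_mul_assoc orthogonal_matrix_cancel[OF g] .
    qed
    from multilinear_fixed_by_root[OF r(1) multilinear_compose[OF T[OF N]] this, of "map ((*v) g) zs"]
    show "T (map ((*v) (transpose g ** r ** g)) zs) = T zs"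
      unfolding mm[symmetric] matrix_mul_assoc orthogonal_matrix_cancel[OF g] m1 by simp
  qed
  have F: "transpose (adj h ** h) ** th \<in> F"
    unfolding F_def
  proof (clarsimp, intro conjI allI impI ballI, safe)
    show "orthogonal_matrix (transpose (adj h ** h) ** th)"
      using h th by (simp add: orthogonal_matrix_product orthogonal_matrix_adj)
    fix N T and zs :: "(complex^'n) list" assume N: "(length zs, T) \<in> I"
    \<comment> \<open>The matrix is a composition of two antilinear maps: the conjugation handled by
      \<open>real1\<close>, and the standard one transported by \<open>h\<close>, handled by
      \<open>real2\<close>. The two complex conjugations of the value cancel.\<close>
    have "(transpose (adj h ** h) ** th) *v z = transpose h *v cnjv (h *v (th *v cnjv z))" for z
      by (simp add: adj_def matrix_transpose_mul cnjv_mult_vec th(2) flip: matrix_vector_mul_assoc)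
    then have fe: "(*v) (transpose (adj h ** h) ** th) = (\<lambda>z. transpose h *v cnjv (h *v (th *v cnjv z)))"
      by (rule ext)
    have "T (map ((*v) (transpose (adj h ** h) ** th)) zs)
        = T (map (\<lambda>z. transpose h *v cnjv z) (map (\<lambda>z. h *v (th *v cnjv z)) zs))"
      by (simp only: fe map_map o_def)
    also have "\<dots> = cnj (T (map (\<lambda>z. transpose h *v z) (map (\<lambda>z. h *v (th *v cnjv z)) zs)))"
      by (rule real2[OF N]) simp
    also have "\<dots> = cnj (T (map (\<lambda>z. th *v cnjv z) zs))"
      by (simp only: map_map o_def matrix_vector_mul_assoc matrix_mul_assoc
          orthogonal_matrix_cancel[OF h] matrix_mul_lid)
    also have "\<dots> = T zs" by (simp add: real1[OF N])
    finally show "T (map ((*v) (transpose (adj h ** h) ** th)) zs) = T zs" .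
  qed
  obtain s k where sk: "orthogonal_matrix s" "orthogonal_matrix k" "th ** cnjm s = s ** th" "cnjm k = k"
    "transpose h ** transpose k ** s \<in> F"
    using conjugate_real_element_exists[OF th h F_mult F_inv F_root F] by blast
  have "T (map (\<lambda>z. transpose s *v z) zs) = T (map (\<lambda>z. transpose h *v (transpose k *v z)) zs)"
    if N: "(N, T) \<in> I" "length zs = N" for N T zs
  proof -
    \<comment> \<open>Evaluating the stabiliser relation on arguments moved by
      \<open>transpose s\<close> cancels the factor \<open>s\<close>.\<close>
    have "T (map ((*v) (transpose h ** transpose k ** s)) (map ((*v) (transpose s)) zs))
        = T (map ((*v) (transpose s)) zs)"
      using FD[OF sk(5) N(1), of "map ((*v) (transpose s)) zs"] N(2) by simp
    then show ?thesis
      by (simp only: map_map o_def matrix_vector_mul_assoc matrix_mul_assoc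
          orthogonal_matrix_cancel[OF sk(1)])
  qed
  then show ?thesis using that sk by blast
qed

section \<open>Real forms and orthonormal frames\<close>

lemma rvec_subspace_imp:
  assumes "rvec.subspace W"
  shows "0 \<in> W" "u \<in> W \<Longrightarrow> v \<in> W \<Longrightarrow> u + v \<in> W" "u \<in> W \<Longrightarrow> rscale r u \<in> W"
  using assms by (auto simp: rvec.subspace_def)

lemma rvec_span_subset_cvec_span: "rvec.span S \<subseteq> cvec.span S"
proof (rule rvec.span_minimal[OF cvec.span_superset])
  show "rvec.subspace (cvec.span S)"
    by (auto simp: rvec.subspace_def rscale_def cvec.span_zero cvec.span_add cvec.span_scale)
qed

lemma real_form_subset:
  assumes "real_form E W" "u \<in> W"
  shows "u \<in> E"
proof -
  have "u = u + cscale \<i> 0" by simp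
  moreover have "0 \<in> W" using assms rvec_subspace_imp by (auto simp: real_form_def)
  ultimately show ?thesis using assms unfolding real_form_def by blast
qed

lemma real_form_decompose:
  assumes "real_form E W" "v \<in> E"
  obtains u w where "u \<in> W" "w \<in> W" "v = u + cscale \<i> w"
  using assms by (auto simp: real_form_def)

text \<open>In \<open>W + \<i> W\<close> multiplication by \<open>\<i>\<close> exchanges the
  summands up to sign. The vector space structure of the tangent space is obtained here, not from
  the chart transitions.\<close>

lemma real_form_subspace:
  assumes W: "real_form E W"
  shows "cvec.subspace E"
proof -
  have sub: "rvec.subspace W" using W by (simp add: real_form_def)
  note W' = rvec_subspace_imp[OF sub]
  have mem: "u \<in> W \<Longrightarrow> w \<in> W \<Longrightarrow> u + cscale \<i> w \<in> E" for u w
    using W by (auto simp: real_form_def)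
  show ?thesis unfolding cvec.subspace_def
  proof (intro conjI ballI allI)
    show "0 \<in> E" using real_form_subset[OF W W'(1)] .
  next
    fix x y assume x: "x \<in> E" and y: "y \<in> E"
    obtain u w where uw: "u \<in> W" "w \<in> W" "x = u + cscale \<i> w"
      by (rule real_form_decompose[OF W x])
    obtain u' w' where uw': "u' \<in> W" "w' \<in> W" "y = u' + cscale \<i> w'"
      by (rule real_form_decompose[OF W y])
    have xy: "x + y = (u + u') + cscale \<i> (w + w')"
      by (simp add: uw uw' cvec.scale_right_distrib)
    show "x + y \<in> E" unfolding xy by (intro mem W'(2) uw uw')
  next
    fix c x assume "x \<in> E"
    obtain u w where uw: "u \<in> W" "w \<in> W" and x: "x = u + cscale \<i> w"
      by (rule real_form_decompose[OF W \<open>x \<in> E\<close>])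
    have c: "c = of_real (Re c) + \<i> * of_real (Im c)" "c * \<i> = of_real (- Im c) + \<i> * of_real (Re c)"
      by (simp_all add: complex_eq_iff)
    have 1: "cscale (of_real r + \<i> * of_real t) v = rscale r v + cscale \<i> (rscale t v)" for r t v
      by (simp add: cvec.scale_left_distrib rscale_def)
    have "cscale c x = cscale c u + cscale (c * \<i>) w"
      by (simp add: x cvec.scale_right_distrib)
    also have "\<dots> = (rscale (Re c) u + cscale \<i> (rscale (Im c) u))
        + (rscale (- Im c) w + cscale \<i> (rscale (Re c) w))"
      using 1[of "Re c" "Im c" u] 1[of "- Im c" "Re c" w] by (simp only: c(1)[symmetric] c(2)[symmetric])
    also have "\<dots> = (rscale (Re c) u + rscale (- Im c) w) + cscale \<i> (rscale (Im c) u + rscale (Re c) w)"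
      by (simp only: cvec.scale_right_distrib add_ac)
    finally have cx: "cscale c x
      = (rscale (Re c) u + rscale (- Im c) w) + cscale \<i> (rscale (Im c) u + rscale (Re c) w)" .
    show "cscale c x \<in> E" unfolding cx by (intro mem W'(2,3) uw)
  qed
qed

lemma conjugation_of_decomposed:
  assumes "conjugation_of E W s" "cvec.subspace E" "u \<in> W" "w \<in> W" "W \<subseteq> E"
  shows "s (u + cscale \<i> w) = u + cscale (- \<i>) w"
  using assms by (auto simp: conjugation_of_def cvec.subspace_scale subset_iff)

text \<open>The imaginary part of a fixed vector equals its own negative. Preserving a real form
  thereby reduces to commuting with its conjugation.\<close>

lemma conjugation_fixed_imp_mem:
  assumes W: "real_form E W" and s: "conjugation_of E W s" and v: "v \<in> E" "s v = v"
  shows "v \<in> W"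
proof -
  obtain u w where uw: "u \<in> W" "w \<in> W" and x: "v = u + cscale \<i> w"
    by (rule real_form_decompose[OF W v(1)])
  have "W \<subseteq> E" using real_form_subset[OF W] by blast
  from conjugation_of_decomposed[OF s real_form_subspace[OF W] uw this] v(2)
  have "cscale (- \<i>) w = cscale \<i> w" by (simp add: x)
  then have "w = 0" by (simp add: cscale_def fun_eq_iff vec_eq_iff)
  then show ?thesis using uw x by simp
qed

section \<open>Complex quadratic spaces and orthonormal frames\<close>

locale complex_quadratic_space =
  fixes E :: "('i \<Rightarrow> complex^'n::finite) set" and b
  assumes metric: "complex_metric_on E b" and subspace: "cvec.subspace E"
begin

lemma mem [simp, intro]: "0 \<in> E" "u \<in> E \<Longrightarrow> v \<in> E \<Longrightarrow> u + v \<in> E" "u \<in> E \<Longrightarrow> cscale c u \<in> E"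
  using subspace by (auto simp: cvec.subspace_def)

lemma sum_mem [intro]: "(\<And>i. i \<in> I \<Longrightarrow> f i \<in> E) \<Longrightarrow> (\<Sum>i\<in>I. f i) \<in> E"
  using subspace by (rule cvec.subspace_sum)

lemma sym: "u \<in> E \<Longrightarrow> v \<in> E \<Longrightarrow> b u v = b v u"
  using metric unfolding complex_metric_on_def by blast

lemma add_left: "u \<in> E \<Longrightarrow> v \<in> E \<Longrightarrow> w \<in> E \<Longrightarrow> b (u + v) w = b u w + b v w"
  using metric unfolding complex_metric_on_def by blast

lemma scale_left: "u \<in> E \<Longrightarrow> w \<in> E \<Longrightarrow> b (cscale c u) w = c * b u w"
  using metric unfolding complex_metric_on_def by blast

lemma add_right: "u \<in> E \<Longrightarrow> v \<in> E \<Longrightarrow> w \<in> E \<Longrightarrow> b w (u + v) = b w u + b w v"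
  using add_left[of u v w] sym by simp

lemma scale_right: "u \<in> E \<Longrightarrow> w \<in> E \<Longrightarrow> b w (cscale c u) = c * b w u"
  using scale_left[of u w c] sym by simp

lemma zero_left: "w \<in> E \<Longrightarrow> b 0 w = 0"
  using add_left[of 0 0 w] by simp

lemma sum_left: "(\<And>i. i \<in> I \<Longrightarrow> f i \<in> E) \<Longrightarrow> w \<in> E \<Longrightarrow>
    b (\<Sum>i\<in>I. cscale (c i) (f i)) w = (\<Sum>i\<in>I. c i * b (f i) w)"
proof (induction I rule: infinite_finite_induct)
  case (insert i I)
  have "(\<Sum>i\<in>I. cscale (c i) (f i)) \<in> E" using insert.prems by (intro sum_mem) auto
  then have "b (cscale (c i) (f i) + (\<Sum>i\<in>I. cscale (c i) (f i))) w
      = c i * b (f i) w + b (\<Sum>i\<in>I. cscale (c i) (f i)) w"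
    using insert.prems by (simp only: add_left scale_left mem insert_iff simp_thms)
  moreover have "b (\<Sum>i\<in>I. cscale (c i) (f i)) w = (\<Sum>i\<in>I. c i * b (f i) w)"
    using insert.prems by (intro insert.IH) auto
  ultimately show ?case unfolding sum.insert[OF insert.hyps] by (simp only:)
qed (simp_all add: zero_left)

lemma sum_right: "(\<And>i. i \<in> I \<Longrightarrow> f i \<in> E) \<Longrightarrow> w \<in> E \<Longrightarrow>
    b w (\<Sum>i\<in>I. cscale (c i) (f i)) = (\<Sum>i\<in>I. c i * b w (f i))"
  using sum_left[of I f w c] sym by (simp add: sum_mem)

text \<open>Both sides are conjugate-linear in each argument and agree on \<open>W\<close>, where
  \<open>b\<close> is real.\<close>

lemma conjugation_form:
  assumes W: "real_form E W" "real_slice E b W" "conjugation_of E W s" and uv: "u \<in> E" "v \<in> E"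
  shows "b (s u) (s v) = cnj (b u v)"
proof -
  obtain u1 u2 where u: "u1 \<in> W" "u2 \<in> W" "u = u1 + cscale \<i> u2"
    by (rule real_form_decompose[OF W(1) uv(1)])
  obtain v1 v2 where v: "v1 \<in> W" "v2 \<in> W" "v = v1 + cscale \<i> v2"
    by (rule real_form_decompose[OF W(1) uv(2)])
  have WE: "W \<subseteq> E" using W(2) by (simp add: real_slice_def)
  then have E: "u1 \<in> E" "u2 \<in> E" "v1 \<in> E" "v2 \<in> E" using u v by auto
  have real: "cnj (b x y) = b x y" if "x \<in> W" "y \<in> W" for x y
    using W(2) that by (simp add: real_slice_def Reals_cnj_iff)
  have s: "s u = u1 + cscale (- \<i>) u2" "s v = v1 + cscale (- \<i>) v2"
    using conjugation_of_decomposed[OF W(3) subspace _ _ WE] u v by auto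
  show ?thesis
    unfolding s unfolding u(3) v(3)
    by (simp add: E add_left add_right scale_left scale_right real[OF u(1)  v(1)] real[OF u(1) v(2)]
        real[OF u(2) v(1)] real[OF u(2) v(2)] del: cvec.scale_minus_left)
qed

lemma orthogonal_imp_independent:
  assumes "finite B" "B \<subseteq> E" and orth: "\<And>u v. u \<in> B \<Longrightarrow> v \<in> B \<Longrightarrow> u \<noteq> v \<Longrightarrow> b u v = 0"
    and nz: "\<And>u. u \<in> B \<Longrightarrow> b u u \<noteq> 0"
  shows "cvec.independent B"
proof
  assume "cvec.dependent B"
  then obtain c where c: "\<exists>v\<in>B. c v \<noteq> 0" "(\<Sum>v\<in>B. cscale (c v) v) = 0"
    using cvec.dependent_finite[OF assms(1)] by auto
  then obtain v where v: "v \<in> B" "c v \<noteq> 0" by blast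
  have "b (\<Sum>v\<in>B. cscale (c v) v) v = (\<Sum>u\<in>B. c u * b u v)"
    using assms(2) v by (intro sum_left) auto
  also have "\<dots> = (\<Sum>u\<in>B. if u = v then c v * b v v else 0)"
    using orth v by (intro sum.cong) auto
  also have "\<dots> = c v * b v v" using v assms(1) by simp
  finally show False using c v nz[OF v(1)] zero_left[of v] assms(2) by auto
qed

end

text \<open>The signature supplies the dimension: an orthonormal family that spans \<open>W\<close>
  over the reals is a complex basis of \<open>E\<close>.\<close>

lemma has_signature_imp_basis:
  assumes bE: "complex_quadratic_space E b" and W: "real_form E W" "has_signature W b p q"
  obtains S where "finite S" "card S = p + q" "cvec.independent S" "E \<subseteq> cvec.span S" "S \<subseteq> E"
proof -
  interpret complex_quadratic_space E b by fact
  obtain e :: "nat \<Rightarrow> 'a \<Rightarrow> complex^'b" where e: "rvec.span (e ` {..<p + q}) = W"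
    "\<And>j k. j < p + q \<Longrightarrow> k < p + q \<Longrightarrow> b (e j) (e k) = (if j \<noteq> k then 0 else if j < p then 1 else -1)"
    using W(2) unfolding has_signature_def by blast
  let ?S = "e ` {..<p + q}"
  have SW: "?S \<subseteq> W" unfolding e(1)[symmetric] by (rule rvec.span_superset)
  then have SE: "?S \<subseteq> E" using real_form_subset[OF W(1)] by blast
  have "inj_on e {..<p + q}"
  proof (rule inj_onI)
    fix j k assume jk: "j \<in> {..<p + q}" "k \<in> {..<p + q}" "e j = e k"
    then have "b (e j) (e k) \<noteq> 0" using e(2)[of k k] by auto
    then show "j = k" using e(2)[of j k] jk by (auto split: if_splits)
  qed
  then have "card ?S = p + q" by (simp add: card_image)
  moreover have "cvec.independent ?S"
    using SE e(2) by (intro orthogonal_imp_independent) (auto split: if_splits)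
  moreover have "E \<subseteq> cvec.span ?S"
  proof
    fix v assume "v \<in> E"
    obtain u w where "u \<in> W" "w \<in> W" "v = u + cscale \<i> w"
      by (rule real_form_decompose[OF W(1) \<open>v \<in> E\<close>])
    then show "v \<in> cvec.span ?S"
      using e(1) rvec_span_subset_cvec_span[of ?S] by (auto intro!: cvec.span_add cvec.span_scale)
  qed
  ultimately show ?thesis using that SE by blast
qed

text \<open>The index type is \<open>'n\<close> itself, so that coordinate vectors have type
  \<open>complex^'n\<close> and isometries become square matrices.\<close>

locale orthonormal_frame = complex_quadratic_space E b
  for E :: "('i \<Rightarrow> complex^'n::finite) set" and b +
  fixes e :: "'n \<Rightarrow> 'i \<Rightarrow> complex^'n"
  assumes frame_mem [simp]: "e i \<in> E"
    and frame_orthonormal: "b (e i) (e j) = (if i = j then 1 else 0)"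
    and frame_expand: "v \<in> E \<Longrightarrow> v = (\<Sum>i\<in>UNIV. cscale (b (e i) v) (e i))"

text \<open>A largest orthonormal subset of \<open>W\<close> expands every vector of
  \<open>W\<close>, since a Gram-Schmidt step would otherwise enlarge it. Comparison with the basis
  \<open>S\<close> shows that it can be indexed by \<open>'n\<close>.\<close>

lemma orthonormal_frame_exists:
  fixes E :: "('i \<Rightarrow> complex^'n::finite) set"
  assumes bE: "complex_quadratic_space E b" and W: "real_form E W" "real_slice E b W"
    and pos: "positive_definite_on W b"
    and S: "finite S" "card S = CARD('n)" "cvec.independent S" "E \<subseteq> cvec.span S" "S \<subseteq> E"
  obtains e where "orthonormal_frame E b e" "\<And>i. e i \<in> W"
proof -
  interpret complex_quadratic_space E b by fact
  have WE: "W \<subseteq> E" using W(2) by (simp add: real_slice_def)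
  have subW: "rvec.subspace W" using W(2) by (simp add: real_slice_def)
  note W' = rvec_subspace_imp[OF subW]
  define P where "P B \<longleftrightarrow> finite B \<and> B \<subseteq> W \<and> (\<forall>u\<in>B. \<forall>v\<in>B. b u v = (if u = v then 1 else 0))" for B
  have ind: "cvec.independent B" if "P B" for B
    using that WE unfolding P_def by (intro orthogonal_imp_independent) auto
  have bound: "card B \<le> CARD('n)" if "P B" for B
  proof -
    have "B \<subseteq> cvec.span S" using that S(4) WE by (auto simp: P_def)
    then show ?thesis using cvec.independent_span_bound[OF S(1) ind[OF that]] S(2) by simp
  qed
  have "P {}" by (simp add: P_def)
  then obtain B where B: "P B" and max: "\<And>B'. P B' \<Longrightarrow> card B' \<le> card B"
    using ex_has_greatest_nat[of P "{}" card "Suc CARD('n)"] bound by (auto simp: less_Suc_eq_le)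
  have fin: "finite B" and BW: "B \<subseteq> W" and BE: "B \<subseteq> E"
    and on: "\<And>u v. u \<in> B \<Longrightarrow> v \<in> B \<Longrightarrow> b u v = (if u = v then 1 else 0)"
    using B WE by (auto simp: P_def)
  have expand_W: "w = (\<Sum>u\<in>B. cscale (b u w) u)" if w: "w \<in> W" for w
  proof (rule ccontr)
    assume ne: "w \<noteq> (\<Sum>u\<in>B. cscale (b u w) u)"
    define y where "y = (\<Sum>u\<in>B. cscale (b u w) u)"
    define z where "z = w + cscale (-1) y"
    \<comment> \<open>On \<open>W\<close> the coefficients are real, which keeps the projection
      \<open>y\<close> inside \<open>W\<close>.\<close>
    have cr: "cscale (b u w) u = rscale (Re (b u w)) u" if "u \<in> B" for u
      using W(2) that BW w by (auto simp: real_slice_def rscale_def subset_iff)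
    have "y \<in> W" unfolding y_def
      using cr W'(3) BW by (intro rvec.subspace_sum[OF subW]) auto
    then have "w + rscale (-1) y \<in> W" by (intro W'(2,3) w)
    then have zW: "z \<in> W" by (simp add: z_def rscale_def)
    have "z \<noteq> 0" using ne by (simp add: z_def y_def)
    have wE: "w \<in> E" and yE: "y \<in> E" and zE: "z \<in> E" using WE w \<open>y \<in> W\<close> zW by auto
    have bz: "b v z = 0" if v: "v \<in> B" for v
    proof -
      have "b v y = (\<Sum>u\<in>B. b u w * b v u)" unfolding y_def using BE v by (intro sum_right) auto
      also have "\<dots> = (\<Sum>u\<in>B. if u = v then b v w else 0)" using on v by (intro sum.cong) auto
      also have "\<dots> = b v w" using v fin by simp
      finally show ?thesis
        using v BE wE yE by (simp add: z_def add_right scale_right subset_iff del: cvec.scale_minus_left)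
    qed
    have zz: "b z z \<in> \<real>" "Re (b z z) > 0"
      using pos zW \<open>z \<noteq> 0\<close> by (auto simp: positive_definite_on_def)
    define r where "r = 1 / sqrt (Re (b z z))"
    define x where "x = cscale (of_real r) z"
    have xW: "x \<in> W" using W'(3)[OF zW, of r] by (simp add: x_def rscale_def)
    have "b x x = of_real (r * r * Re (b z z))"
      using zE zz(1) by (simp add: x_def scale_left scale_right)
    also have "r * r * Re (b z z) = 1" using zz(2) by (simp add: r_def)
    finally have xx: "b x x = 1" by simp
    have bx: "b v x = 0" "b x v = 0" if "v \<in> B" for v
      using that bz[OF that] sym[of v z] BE zE by (auto simp: x_def scale_right scale_left subset_iff)
    have "x \<notin> B" using bx(1)[of x] xx by auto
    have "P (insert x B)"
      using B xW xx bx \<open>x \<notin> B\<close> unfolding P_def by auto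
    from max[OF this] show False using \<open>x \<notin> B\<close> fin by simp
  qed
  have expand: "v = (\<Sum>u\<in>B. cscale (b u v) u)" if "v \<in> E" for v
  proof -
    obtain u w where uw: "u \<in> W" "w \<in> W" and v: "v = u + cscale \<i> w"
      by (rule real_form_decompose[OF W(1) \<open>v \<in> E\<close>])
    have uwE: "u \<in> E" "w \<in> E" using uw WE by auto
    have "v = (\<Sum>x\<in>B. cscale (b x u) x) + cscale \<i> (\<Sum>x\<in>B. cscale (b x w) x)"
      using expand_W[OF uw(1)] expand_W[OF uw(2)] v by simp
    also have "\<dots> = (\<Sum>x\<in>B. cscale (b x v) x)"
      unfolding cvec.scale_sum_right sum.distrib[symmetric]
      using uwE BE by (intro sum.cong)
        (auto simp: v add_right scale_right cvec.scale_left_distrib subset_iff)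
    finally show ?thesis .
  qed
  have "S \<subseteq> cvec.span B"
  proof
    fix v assume "v \<in> S"
    then have "v = (\<Sum>u\<in>B. cscale (b u v) u)" using S(5) expand by blast
    also have "\<dots> \<in> cvec.span B" by (intro cvec.span_sum cvec.span_scale cvec.span_base)
    finally show "v \<in> cvec.span B" .
  qed
  then have "CARD('n) \<le> card B" using cvec.independent_span_bound[OF fin S(3)] S(2) by simp
  then have "card B = CARD('n)" using bound[OF B] by simp
  then obtain e where e: "bij_betw e (UNIV :: 'n set) B"
    using finite_same_card_bij[of "UNIV :: 'n set" B] fin by auto
  have eB: "e i \<in> B" for i using e by (auto simp: bij_betw_def)
  have "orthonormal_frame E b e"
  proof (unfold_locales)
    show "e i \<in> E" for i using eB BE by auto
    show "b (e i) (e j) = (if i = j then 1 else 0)" for i j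
      using e eB on[of "e i" "e j"] by (auto simp: bij_betw_def inj_on_def)
    show "v = (\<Sum>i\<in>UNIV. cscale (b (e i) v) (e i))" if "v \<in> E" for v
      using expand[OF that] sum.reindex_bij_betw[OF e, of "\<lambda>u. cscale (b u v) u"] by simp
  qed
  then show ?thesis using that eB BW by blast
qed

section \<open>Tensors in an orthonormal frame\<close>

definition cdot :: "complex^'n \<Rightarrow> complex^'n \<Rightarrow> complex" where
  "cdot z w = (\<Sum>i\<in>UNIV. z $ i * w $ i)"

lemma cdot_mult_vec: "cdot (A *v z) w = cdot z (transpose A *v w)" for A :: "complex^'n^'n"
proof -
  have "cdot (A *v z) w = (\<Sum>i\<in>UNIV. \<Sum>j\<in>UNIV. A $ i $ j * z $ j * w $ i)"
    unfolding cdot_def matrix_vector_mult_def by (simp add: sum_distrib_right)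
  also have "\<dots> = (\<Sum>j\<in>UNIV. \<Sum>i\<in>UNIV. A $ i $ j * z $ j * w $ i)" by (rule sum.swap)
  also have "\<dots> = cdot z (transpose A *v w)"
    unfolding cdot_def matrix_vector_mult_def transpose_def by (simp add: sum_distrib_left mult_ac)
  finally show ?thesis .
qed

lemma cdot_axis: "cdot (axis i 1) w = w $ i"
proof -
  have "cdot (axis i 1) w = (\<Sum>j\<in>UNIV. if j = i then w $ i else 0)"
    unfolding cdot_def by (rule sum.cong) (auto simp: axis_def)
  then show ?thesis by simp
qed

lemma orthogonal_matrix_if_preserves_cdot:
  fixes A :: "complex^'n^'n"
  assumes "\<And>z w. cdot (A *v z) (A *v w) = cdot z w"
  shows "orthogonal_matrix A"
proof -
  have "cdot (axis i 1) (transpose A *v (A *v w)) = cdot (axis i 1) w" for i w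
    using assms[of "axis i 1" w] unfolding cdot_mult_vec .
  then have "transpose A *v (A *v w) = w" for w
    unfolding cdot_axis by (simp only: vec_eq_iff simp_thms)
  then have "transpose A ** A = mat 1"
    unfolding matrix_eq matrix_vector_mul_assoc[symmetric] matrix_vector_mul_lid by blast
  then show ?thesis using matrix_left_right_inverse unfolding orthogonal_matrix_def by blast
qed

lemma orthogonal_matrix_preserves_cdot:
  fixes A :: "complex^'n^'n"
  assumes "orthogonal_matrix A"
  shows "cdot (A *v z) (A *v w) = cdot z w"
  unfolding cdot_mult_vec matrix_vector_mul_assoc orthogonal_matrix_cancel[OF assms] matrix_vector_mul_lid ..

lemma real_tensors_subset: "t \<in> real_tensors E W ty \<Longrightarrow> t \<in> complex_tensors E ty"
  by (simp add: real_tensors_def)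

context orthonormal_frame
begin

definition vec_of :: "complex^'n \<Rightarrow> 'i \<Rightarrow> complex^'n" where
  "vec_of z = (\<Sum>i\<in>UNIV. cscale (z $ i) (e i))"

definition coords :: "('i \<Rightarrow> complex^'n) \<Rightarrow> complex^'n" where
  "coords v = (\<chi> i. b (e i) v)"

lemma vec_of_mem [simp]: "vec_of z \<in> E"
  unfolding vec_of_def by (intro sum_mem mem frame_mem)

lemma vec_of_coords: "v \<in> E \<Longrightarrow> vec_of (coords v) = v"
  using frame_expand[of v] by (simp add: vec_of_def coords_def)

lemma coords_vec_of [simp]: "coords (vec_of z) = z"
proof -
  have "b (e i) (vec_of z) = z $ i" for i
  proof -
    have "b (e i) (vec_of z) = (\<Sum>j\<in>UNIV. z $ j * b (e i) (e j))"
      unfolding vec_of_def by (intro sum_right frame_mem)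
    also have "\<dots> = (\<Sum>j\<in>UNIV. if j = i then z $ i else 0)"
      by (rule sum.cong) (auto simp: frame_orthonormal)
    finally show ?thesis by simp
  qed
  then show ?thesis by (simp add: coords_def vec_eq_iff)
qed

lemma coords_add: "u \<in> E \<Longrightarrow> v \<in> E \<Longrightarrow> coords (u + v) = coords u + coords v"
  by (simp add: coords_def vec_eq_iff add_right)

lemma coords_scale: "u \<in> E \<Longrightarrow> coords (cscale c u) = c *s coords u"
  by (simp add: coords_def vec_eq_iff scale_right)

lemma vec_of_add: "vec_of (u + v) = vec_of u + vec_of v"
  by (metis coords_add coords_vec_of mem(2) vec_of_coords vec_of_mem)

lemma vec_of_scale: "vec_of (c *s u) = cscale c (vec_of u)"
  by (metis coords_scale coords_vec_of mem(3) vec_of_coords vec_of_mem)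

lemma form_vec_of: "b (vec_of z) (vec_of w) = cdot z w"
proof -
  have "b (vec_of z) (vec_of w) = (\<Sum>i\<in>UNIV. z $ i * b (e i) (vec_of w))"
    unfolding vec_of_def[of z] by (intro sum_left frame_mem vec_of_mem)
  moreover have "b (e i) (vec_of w) = w $ i" for i
    using coords_vec_of[of w] by (metis coords_def vec_lambda_beta)
  ultimately show ?thesis by (simp add: cdot_def)
qed

lemma form_coords: "u \<in> E \<Longrightarrow> v \<in> E \<Longrightarrow> cdot (coords u) (coords v) = b u v"
  by (metis form_vec_of vec_of_coords)

lemma orthogonal_group_obtain_matrix:
  assumes h: "h \<in> orthogonal_group E b"
  obtains H where "orthogonal_matrix H" "\<And>z. h (vec_of z) = vec_of (H *v z)"
proof -
  have hE: "h v \<in> E" if "v \<in> E" for v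
    using h that by (auto simp: orthogonal_group_def bij_betw_def)
  have hlin: "h (u + v) = h u + h v" "b (h u) (h v) = b u v" if "u \<in> E" "v \<in> E" for u v
    using h that unfolding orthogonal_group_def by blast+
  have hscale: "h (cscale c u) = cscale c (h u)" if "u \<in> E" for u c
    using h that unfolding orthogonal_group_def by blast
  let ?f = "\<lambda>z. coords (h (vec_of z))"
  have "Vector_Spaces.linear (*s) (*s) ?f"
    unfolding Vector_Spaces.linear_iff
    by (simp add: vec.vector_space_axioms vec_of_add vec_of_scale hlin hscale hE coords_add coords_scale)
  from matrix_works[OF this] have m: "matrix ?f *v z = ?f z" for z .
  have "orthogonal_matrix (matrix ?f)"
    by (rule orthogonal_matrix_if_preserves_cdot)
      (simp add: m form_coords hE hlin form_vec_of)
  moreover have "h (vec_of z) = vec_of (matrix ?f *v z)" for z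
    by (simp add: m vec_of_coords hE)
  ultimately show ?thesis using that by blast
qed

definition matrix_map :: "complex^'n^'n \<Rightarrow> ('i \<Rightarrow> complex^'n) \<Rightarrow> ('i \<Rightarrow> complex^'n)" where
  "matrix_map A v = vec_of (A *v coords v)"

lemma matrix_map_mem [simp]: "matrix_map A v \<in> E"
  by (simp add: matrix_map_def)

lemma matrix_map_vec_of: "matrix_map A (vec_of z) = vec_of (A *v z)"
  by (simp add: matrix_map_def)

lemma matrix_map_orthogonal_group:
  assumes A: "orthogonal_matrix A"
  shows "matrix_map A \<in> orthogonal_group E b"
proof -
  have "bij_betw (matrix_map A) E E"
  proof (rule bij_betw_byWitness[of _ "matrix_map (transpose A)"])
    show "\<forall>v\<in>E. matrix_map (transpose A) (matrix_map A v) = v"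
      "\<forall>v\<in>E. matrix_map A (matrix_map (transpose A) v) = v"
      unfolding matrix_map_def coords_vec_of matrix_vector_mul_assoc orthogonal_matrix_cancel[OF A]
        matrix_vector_mul_lid by (simp_all add: vec_of_coords)
  qed auto
  moreover have "matrix_map A (u + v) = matrix_map A u + matrix_map A v"
    "matrix_map A (cscale c u) = cscale c (matrix_map A u)"
    "b (matrix_map A u) (matrix_map A v) = b u v" if "u \<in> E" "v \<in> E" for u v c
    using that
    by (simp_all add: matrix_map_def coords_add coords_scale matrix_vector_right_distrib
        vector_scalar_commute vec_of_add vec_of_scale form_vec_of
        orthogonal_matrix_preserves_cdot[OF A] form_coords)
  ultimately show ?thesis unfolding orthogonal_group_def by blast
qed

text \<open>\<open>W\<close> is the fixed set of \<open>s\<close>, and a bijection of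
  \<open>E\<close> commuting with \<open>s\<close> maps that set onto itself.\<close>

lemma commuting_imp_real_orthogonal_group:
  assumes h: "h \<in> orthogonal_group E b" and W: "real_form E W" "conjugation_of E W s"
    and comm: "commute_on E h s"
  shows "h \<in> real_orthogonal_group E b W"
proof -
  have bij: "bij_betw h E E" using h by (simp add: orthogonal_group_def)
  have WE: "w \<in> E" if "w \<in> W" for w using real_form_subset[OF W(1) that] .
  have sE: "s v \<in> E" if "v \<in> E" for v using W(2) that by (auto simp: conjugation_of_def)
  have sw: "s w = w" if "w \<in> W" for w using W(2) that by (simp add: conjugation_of_def)
  have hE: "h v \<in> E" if "v \<in> E" for v using bij that by (auto simp: bij_betw_def)
  have "h ` W = W"
  proof (intro equalityI subsetI)
    fix y assume "y \<in> h ` W"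
    then obtain w where w: "w \<in> W" "y = h w" by blast
    have "s y = y" using comm w WE sw unfolding commute_on_def by metis
    then show "y \<in> W" using conjugation_fixed_imp_mem[OF W] w WE hE by blast
  next
    fix w assume w: "w \<in> W"
    then obtain u where u: "u \<in> E" "w = h u" using bij WE by (auto simp: bij_betw_def)
    have "h (s u) = h u" using comm u w sw unfolding commute_on_def by metis
    then have "s u = u" using bij u sE unfolding bij_betw_def inj_on_def by blast
    then show "w \<in> h ` W" using conjugation_fixed_imp_mem[OF W u(1)] u by blast
  qed
  then show ?thesis using h by (simp add: real_orthogonal_group_def)
qed

text \<open>The lowering of an index by the metric, padded with \<open>0\<close> outside
  \<open>E\<close> to match \<open>dual_space\<close>.\<close>

definition flat :: "('i \<Rightarrow> complex^'n) \<Rightarrow> ('i \<Rightarrow> complex^'n) \<Rightarrow> complex" where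
  "flat w = (\<lambda>u. if u \<in> E then b w u else 0)"

lemma flat_mem_dual: "w \<in> E \<Longrightarrow> flat w \<in> dual_space E"
  by (simp add: flat_def dual_space_def add_right scale_right)

lemma dual_space_sum:
  assumes "\<alpha> \<in> dual_space E" "\<And>i. i \<in> I \<Longrightarrow> f i \<in> E"
  shows "\<alpha> (\<Sum>i\<in>I. cscale (c i) (f i)) = (\<Sum>i\<in>I. c i * \<alpha> (f i))"
proof -
  have add: "\<alpha> (u + v) = \<alpha> u + \<alpha> v" and scale: "\<alpha> (cscale c u) = c * \<alpha> u"
    if "u \<in> E" "v \<in> E" for u v c
    using assms(1) that unfolding dual_space_def by blast+
  have zero: "\<alpha> 0 = 0" using add[of 0 0] by simp
  show ?thesis using assms(2)
  proof (induction I rule: infinite_finite_induct)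
    case (insert i I)
    have "(\<Sum>i\<in>I. cscale (c i) (f i)) \<in> E" using insert.prems by (intro sum_mem mem) auto
    then have "\<alpha> (cscale (c i) (f i) + (\<Sum>i\<in>I. cscale (c i) (f i)))
        = c i * \<alpha> (f i) + \<alpha> (\<Sum>i\<in>I. cscale (c i) (f i))"
      using insert.prems by (simp only: add scale mem insert_iff simp_thms)
    moreover have "\<alpha> (\<Sum>i\<in>I. cscale (c i) (f i)) = (\<Sum>i\<in>I. c i * \<alpha> (f i))"
      using insert.prems by (intro insert.IH) auto
    ultimately show ?case unfolding sum.insert[OF insert.hyps] by (simp only:)
  qed (simp_all add: zero)
qed

text \<open>An orthonormal frame is its own dual basis, so the values of a covector on the frame are
  the coordinates of the vector representing it.\<close>

lemma dual_eq_flat: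
  assumes \<alpha>: "\<alpha> \<in> dual_space E"
  shows "\<alpha> = flat (vec_of (\<chi> i. \<alpha> (e i)))"
proof
  fix u
  show "\<alpha> u = flat (vec_of (\<chi> i. \<alpha> (e i))) u"
  proof (cases "u \<in> E")
    case True
    have "\<alpha> u = \<alpha> (vec_of (coords u))" using True by (simp add: vec_of_coords)
    also have "\<dots> = (\<Sum>i\<in>UNIV. coords u $ i * \<alpha> (e i))"
      unfolding vec_of_def by (intro dual_space_sum \<alpha> frame_mem)
    also have "\<dots> = cdot (\<chi> i. \<alpha> (e i)) (coords u)" by (simp add: cdot_def mult.commute)
    also have "\<dots> = b (vec_of (\<chi> i. \<alpha> (e i))) (vec_of (coords u))" by (simp add: form_vec_of)
    finally show ?thesis using True by (simp add: flat_def vec_of_coords)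
  qed (use \<alpha> in \<open>auto simp: flat_def dual_space_def\<close>)
qed

text \<open>A tensor with \<open>k\<close> covector slots as a multilinear function of coordinate vectors only, the
  covectors being identified with vectors by the metric; the orthogonal group then acts in the same
  way on all slots.\<close>

definition tform :: "nat \<Rightarrow> ('i, 'n) tensor \<Rightarrow> (complex^'n) list \<Rightarrow> complex" where
  "tform k t zs = t (map (\<lambda>z. flat (vec_of z)) (take k zs)) (map vec_of (drop k zs))"

lemma tensor_args_of_coords:
  assumes "length zs = fst ty + snd ty"
  shows "(map (\<lambda>z. flat (vec_of z)) (take (fst ty) zs), map vec_of (drop (fst ty) zs)) \<in> tensor_args E ty"
  using assms by (auto simp: tensor_args_def flat_mem_dual)

lemma tensor_args_obtain_coords:
  assumes "(as, vs) \<in> tensor_args E ty"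
  obtains zs where "length zs = fst ty + snd ty"
    "as = map (\<lambda>z. flat (vec_of z)) (take (fst ty) zs)" "vs = map vec_of (drop (fst ty) zs)"
proof -
  have a: "length as = fst ty" "length vs = snd ty" "set as \<subseteq> dual_space E" "set vs \<subseteq> E"
    using assms by (auto simp: tensor_args_def)
  let ?zs = "map (\<lambda>\<alpha>. \<chi> i. \<alpha> (e i)) as @ map coords vs"
  have "as = map (\<lambda>z. flat (vec_of z)) (take (fst ty) ?zs)"
    using a dual_eq_flat by (auto simp: o_def intro!: map_idI[symmetric])
  moreover have "vs = map vec_of (drop (fst ty) ?zs)"
    using a vec_of_coords by (auto simp: o_def intro!: map_idI[symmetric])
  ultimately show ?thesis using that[of ?zs] a by simp
qed

lemma multilinear_tform:
  assumes t: "t \<in> complex_tensors E ty"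
  shows "multilinear (fst ty + snd ty) (tform (fst ty) t)"
  unfolding multilinear_def
proof (intro allI impI)
  fix zs :: "(complex^'n) list" and j u w c
  assume zs: "length zs = fst ty + snd ty" and j: "j < fst ty + snd ty"
  let ?k = "fst ty"
  let ?as = "map (\<lambda>z. flat (vec_of z)) (take ?k zs)" and ?vs = "map vec_of (drop ?k zs)"
  note args = tensor_args_of_coords[OF zs]
  show "tform ?k t (zs[j := u + c *s w]) = tform ?k t (zs[j := u]) + c * tform ?k t (zs[j := w])"
  \<comment> \<open>The first \<open>?k\<close> slots are covector slots, where linearity goes
    through \<open>flat\<close>; the others are vector slots, shifted by \<open>?k\<close>.\<close>
  proof (cases "j < ?k")
    case True
    have eq: "tform ?k t (zs[j := x]) = t (?as[j := flat (vec_of x)]) ?vs" for x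
      using True by (simp add: tform_def take_update_swap map_update)
    have "flat (vec_of (u + c *s w)) = (\<lambda>x. flat (vec_of u) x + c * flat (vec_of w) x)"
      by (auto simp: flat_def vec_of_add vec_of_scale add_left scale_left)
    moreover have "t (?as[j := (\<lambda>x. flat (vec_of u) x + c * flat (vec_of w) x)]) ?vs
        = t (?as[j := flat (vec_of u)]) ?vs + c * t (?as[j := flat (vec_of w)]) ?vs"
      using t args True flat_mem_dual[OF vec_of_mem] unfolding complex_tensors_def by blast
    ultimately show ?thesis unfolding eq by simp
  next
    case False
    have eq: "tform ?k t (zs[j := x]) = t ?as (?vs[j - ?k := vec_of x])" for x
      using False by (simp add: tform_def drop_update_swap map_update)
    have "j - ?k < snd ty" using False j by simp
    then have "t ?as (?vs[j - ?k := vec_of u + cscale c (vec_of w)])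
        = t ?as (?vs[j - ?k := vec_of u]) + c * t ?as (?vs[j - ?k := vec_of w])"
      using t args vec_of_mem unfolding complex_tensors_def by blast
    then show ?thesis unfolding eq vec_of_add vec_of_scale .
  qed
qed

text \<open>Vectors are moved by the inverse of \<open>h\<close>, which has matrix
  \<open>transpose H\<close>. Covectors are composed with \<open>h\<close>, which moves the
  representing vector by the adjoint for \<open>cdot\<close>, again
  \<open>transpose H\<close>.\<close>

lemma tensor_act_tform:
  assumes h: "h \<in> orthogonal_group E b" "orthogonal_matrix H" "\<And>z. h (vec_of z) = vec_of (H *v z)"
    and zs: "length zs = fst ty + snd ty"
  shows "tensor_act E h t (map (\<lambda>z. flat (vec_of z)) (take (fst ty) zs)) (map vec_of (drop (fst ty) zs))
    = tform (fst ty) t (map (\<lambda>z. transpose H *v z) zs)"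
proof -
  have bij: "bij_betw h E E" using h by (simp add: orthogonal_group_def)
  have hE: "h v \<in> E" if "v \<in> E" for v using bij that by (auto simp: bij_betw_def)
  have "H *v (transpose H *v z) = z" for z
    unfolding matrix_vector_mul_assoc orthogonal_matrix_cancel[OF h(2)] matrix_vector_mul_lid ..
  then have "h (vec_of (transpose H *v z)) = vec_of z" for z using h(3) by metis
  then have inv: "inv_into E h (vec_of z) = vec_of (transpose H *v z)" for z
    using bij by (metis bij_betw_def inv_into_f_f vec_of_mem)
  have flat: "(\<lambda>u. if u \<in> E then flat (vec_of z) (h u) else 0) = flat (vec_of (transpose H *v z))" for z
  proof
    fix u
    show "(if u \<in> E then flat (vec_of z) (h u) else 0) = flat (vec_of (transpose H *v z)) u"
    proof (cases "u \<in> E")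
      case True
      then obtain x where x: "u = vec_of x" by (metis vec_of_coords)
      have "cdot z (H *v x) = cdot (transpose H *v z) x"
        unfolding cdot_mult_vec transpose_transpose ..
      then show ?thesis by (simp only: x flat_def h(3) form_vec_of vec_of_mem if_True)
    qed (simp add: flat_def)
  qed
  show ?thesis
    using tensor_args_of_coords[OF zs] unfolding tensor_args_def
    by (simp add: tensor_act_def tform_def o_def flat inv take_map drop_map)
qed

lemma tensor_act_eqI:
  assumes t: "t \<in> complex_tensors E ty" "t' \<in> complex_tensors E ty"
    and h: "h \<in> orthogonal_group E b" "orthogonal_matrix H" "\<And>z. h (vec_of z) = vec_of (H *v z)"
    and h': "h' \<in> orthogonal_group E b" "orthogonal_matrix H'" "\<And>z. h' (vec_of z) = vec_of (H' *v z)"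
    and eq: "\<And>zs. length zs = fst ty + snd ty \<Longrightarrow>
      tform (fst ty) t (map (\<lambda>z. transpose H *v z) zs) = tform (fst ty) t' (map (\<lambda>z. transpose H' *v z) zs)"
  shows "tensor_act E h t = tensor_act E h' t'"
proof (intro ext)
  fix as vs
  show "tensor_act E h t as vs = tensor_act E h' t' as vs"
  proof (cases "(as, vs) \<in> tensor_args E ty")
    case True
    then obtain zs where zs: "length zs = fst ty + snd ty"
      "as = map (\<lambda>z. flat (vec_of z)) (take (fst ty) zs)" "vs = map vec_of (drop (fst ty) zs)"
      by (rule tensor_args_obtain_coords)
    show ?thesis
      unfolding zs(2,3) tensor_act_tform[OF h zs(1)] tensor_act_tform[OF h' zs(1)] by (rule eq[OF zs(1)])
  next
    case False
    \<comment> \<open>The action preserves the lengths of both lists, so arguments of the wrong type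
      remain outside the domain of the tensor.\<close>
    have "tensor_act E f s as vs = 0" if "s \<in> complex_tensors E ty" for f s
    proof (cases "set as \<subseteq> dual_space E \<and> set vs \<subseteq> E")
      case True
      then have "length as \<noteq> fst ty \<or> length vs \<noteq> snd ty"
        using False by (auto simp: tensor_args_def)
      then have "(map F as, map G vs) \<notin> tensor_args E ty" for F G
        by (auto simp: tensor_args_def)
      moreover have "s as' vs' = 0" if "(as', vs') \<notin> tensor_args E ty" for as' vs'
        using \<open>s \<in> complex_tensors E ty\<close> that unfolding complex_tensors_def by blast
      ultimately show ?thesis unfolding tensor_act_def by simp
    qed (auto simp: tensor_act_def)
    then show ?thesis using t by simp
  qed
qed

text \<open>As \<open>?S\<close> is antilinear, the conjugate of \<open>?T\<close> composed with it
  is multilinear. It agrees with \<open>?T\<close> on coordinates of vectors of \<open>W\<close>,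
  which \<open>?S\<close> fixes and where \<open>?T\<close> is real; these span over the complex
  numbers.\<close>

lemma tform_conjugate:
  assumes t: "t \<in> real_tensors E W ty" and W: "real_form E W" "real_slice E b W"
    and s: "conjugation_of E W s" and zs: "length zs = fst ty + snd ty"
  shows "tform (fst ty) t (map (\<lambda>z. coords (s (vec_of z))) zs) = cnj (tform (fst ty) t zs)"
proof -
  let ?N = "fst ty + snd ty" and ?T = "tform (fst ty) t" and ?S = "\<lambda>z. coords (s (vec_of z))"
  have T: "multilinear ?N ?T" using t by (intro multilinear_tform real_tensors_subset)
  have WE: "w \<in> E" if "w \<in> W" for w using real_form_subset[OF W(1) that] .
  have sE: "s v \<in> E" if "v \<in> E" for v using s that by (auto simp: conjugation_of_def)
  have S: "?S (u + c *s w) = ?S u + cnj c *s ?S w" for u c w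
  proof -
    have "s (vec_of u + cscale c (vec_of w)) = s (vec_of u) + cscale (cnj c) (s (vec_of w))"
      using s vec_of_mem mem(3) unfolding conjugation_of_def by metis
    then show ?thesis by (simp add: vec_of_add vec_of_scale coords_add coords_scale sE)
  qed
  have "multilinear ?N (\<lambda>zs. cnj (?T (map ?S zs)))"
    unfolding multilinear_def
    by (simp add: map_update S multilinear_add_scale[OF T])
  then have "?T zs = cnj (?T (map ?S zs))"
  proof (rule multilinear_eq_on_spanning[OF T _ _ _ zs])
    show "vec.span (coords ` W) = UNIV"
    proof (intro equalityI subsetI UNIV_I)
      fix z :: "complex^'n"
      obtain u w where uw: "u \<in> W" "w \<in> W" "vec_of z = u + cscale \<i> w"
        by (rule real_form_decompose[OF W(1) vec_of_mem])
      then have "coords (vec_of z) = coords u + \<i> *s coords w"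
        by (simp only: coords_add coords_scale WE mem)
      then have "z = coords u + \<i> *s coords w" by simp
      also have "\<dots> \<in> vec.span (coords ` W)"
        using uw by (intro vec.span_add vec.span_scale vec.span_base) auto
      finally show "z \<in> vec.span (coords ` W)" .
    qed
  next
    fix us :: "(complex^'n) list"
    assume us: "length us = ?N" "set us \<subseteq> coords ` W"
    have uW: "vec_of u \<in> W" "?S u = u" if u: "u \<in> set us" for u
    proof -
      obtain w where w: "w \<in> W" "u = coords w" using us(2) u by blast
      then show "vec_of u \<in> W" by (simp add: vec_of_coords WE)
      then have "s (vec_of u) = vec_of u" using s by (simp add: conjugation_of_def)
      then show "?S u = u" by simp
    qed
    have "?T us \<in> \<real>"
    proof -
      let ?as = "map (\<lambda>z. flat (vec_of z)) (take (fst ty) us)" and ?vs = "map vec_of (drop (fst ty) us)"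
      \<comment> \<open>Lowering the index of a vector of \<open>W\<close> gives a covector real on
        \<open>W\<close>, because \<open>b\<close> is real there.\<close>
      have "\<forall>\<alpha>\<in>set ?as. \<alpha> ` W \<subseteq> \<real>"
        using uW(1) W(2) WE by (auto simp: flat_def real_slice_def dest!: in_set_takeD)
      moreover have "set ?vs \<subseteq> W" using uW(1) by (auto dest: in_set_dropD)
      ultimately show ?thesis
        using t tensor_args_of_coords[OF us(1)] unfolding real_tensors_def tform_def by blast
    qed
    moreover have "map ?S us = us" using uW(2) by (intro map_idI) auto
    ultimately show "?T us = cnj (?T (map ?S us))" by (simp add: Reals_cnj_iff)
  qed
  then show ?thesis by (metis complex_cnj_cnj)
qed

text \<open>The frame vectors lie in \<open>W\<close>, so \<open>s\<close> fixes them, and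
  \<open>s\<close> conjugates the values of \<open>b\<close>.\<close>

lemma coords_conjugation:
  assumes "real_form E W" "real_slice E b W" "conjugation_of E W s" "\<And>i. e i \<in> W" "v \<in> E"
  shows "coords (s v) = cnjv (coords v)"
proof -
  have "b (e i) (s v) = cnj (b (e i) v)" for i
  proof -
    have "s (e i) = e i" using assms(3,4) by (simp add: conjugation_of_def)
    then show ?thesis using conjugation_form[OF assms(1-3) frame_mem[of i] assms(5)] by simp
  qed
  then show ?thesis by (simp add: coords_def cnjv_def)
qed

end

text \<open>The pointwise statement in one quadratic space. A frame in the positive definite real
  form \<open>W\<close> translates it into \<open>multilinear_real_orbits_meet\<close>.\<close>

theorem real_tensor_orbits_meet:
  fixes E :: "('i \<Rightarrow> complex^'n::finite) set"
  assumes metric: "complex_metric_on E b"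
    and V: "real_form E V" "real_slice E b V" "conjugation_of E V s1"
    and W: "real_form E W" "real_slice E b W" "conjugation_of E W s2"
    and comm: "commute_on E s1 s2" and pos: "positive_definite_on W b"
    and sig: "has_signature V b p q" "p + q = CARD('n)"
    and x: "x \<in> real_tensor_sum E V tys" and x': "x' \<in> real_tensor_sum E W tys"
    and rot: "wick_rotatable E b x x'"
  shows "tensor_orbit E (real_orthogonal_group E b V) x \<inter>
    tensor_orbit E (real_orthogonal_group E b W) x' \<noteq> {}"
proof -
  have space: "complex_quadratic_space E b"
    using metric real_form_subspace[OF V(1)] by unfold_locales
  obtain S where S: "finite S" "card S = p + q" "cvec.independent S" "E \<subseteq> cvec.span S" "S \<subseteq> E"
    by (rule has_signature_imp_basis[OF space V(1) sig(1)])
  obtain e where e: "orthonormal_frame E b e" "\<And>i. e i \<in> W"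
    using orthonormal_frame_exists[OF space W(1,2) pos S(1) _ S(3-5)] S(2) sig(2) by metis
  interpret orthonormal_frame E b e by fact

  have s1E: "s1 v \<in> E" if "v \<in> E" for v using V(3) that by (auto simp: conjugation_of_def)
  have s2E: "s2 v \<in> E" if "v \<in> E" for v using W(3) that by (auto simp: conjugation_of_def)
  have s1s1: "s1 (s1 v) = v" if "v \<in> E" for v using V(3) that by (simp add: conjugation_of_def)
  have s1_add: "s1 (u + v) = s1 u + s1 v" if "u \<in> E" "v \<in> E" for u v
    using V(3) that by (simp add: conjugation_of_def)
  have s1_scale: "s1 (cscale c u) = cscale (cnj c) (s1 u)" if "u \<in> E" for u c
    using V(3) that by (simp add: conjugation_of_def)
  note s2_coords = coords_conjugation[OF W(1-3) e(2)]
  have s2_vec_of: "s2 (vec_of z) = vec_of (cnjv z)" for z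
    using s2_coords[OF vec_of_mem, of z] vec_of_coords[OF s2E[OF vec_of_mem], of z] by simp

  define S1 where "S1 z = coords (s1 (vec_of z))" for z
  have S1_vec_of: "vec_of (S1 z) = s1 (vec_of z)" for z
    by (simp add: S1_def vec_of_coords s1E)
  have S1_S1: "S1 (S1 z) = z" for z
    by (subst (1) S1_def) (simp add: S1_vec_of s1s1)
  have S1_cnjv: "S1 (cnjv z) = cnjv (S1 z)" for z
  proof -
    have "s1 (s2 (vec_of z)) = s2 (s1 (vec_of z))" using comm vec_of_mem by (simp add: commute_on_def)
    then show ?thesis by (simp add: S1_def s2_coords s1E flip: s2_vec_of)
  qed
  \<comment> \<open>In coordinates \<open>s2\<close> is \<open>cnjv\<close> and \<open>s1\<close> is
    \<open>S1\<close>; their composition is complex linear, so it has a matrix.\<close>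
  define th where "th = matrix (\<lambda>z. S1 (cnjv z))"
  have cnjv_scale: "cnjv (c *s z) = cnj c *s cnjv z" for c z by (simp add: cnjv_def vec_eq_iff)
  have "Vector_Spaces.linear (*s) (*s) (\<lambda>z. S1 (cnjv z))"
    unfolding Vector_Spaces.linear_iff
    by (simp add: vec.vector_space_axioms cnjv_add cnjv_scale S1_def vec_of_add vec_of_scale
        s1_add s1_scale coords_add coords_scale s1E)
  from matrix_works[OF this] have th: "th *v z = S1 (cnjv z)" for z by (simp add: th_def)
  then have S1: "S1 = (\<lambda>z. th *v cnjv z)" by simp
  \<comment> \<open>Each conjugation conjugates the values of the form, so the composition preserves
    them.\<close>
  have "cdot (th *v z) (th *v w) = cdot z w" for z w
  proof -
    have "cdot (th *v z) (th *v w) = cnj (b (vec_of (cnjv z)) (vec_of (cnjv w)))"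
      unfolding th form_vec_of[symmetric] S1_vec_of
      by (rule conjugation_form[OF V vec_of_mem vec_of_mem])
    also have "\<dots> = cdot z w" unfolding form_vec_of by (simp add: cdot_def cnjv_def)
    finally show ?thesis .
  qed
  then have th_orth: "orthogonal_matrix th" by (rule orthogonal_matrix_if_preserves_cdot)
  \<comment> \<open>\<open>th\<close> is real because \<open>S1\<close> commutes with
    \<open>cnjv\<close>; with \<open>S1\<close> an involution, the same relation makes
    \<open>th\<close> one.\<close>
  have "cnjm th *v z = th *v z" for z
    using cnjv_mult_vec[of th "cnjv z"] by (simp add: th S1_cnjv)
  then have th_cnjm: "cnjm th = th" by (simp only: matrix_eq simp_thms)
  have "th *v (th *v z) = z" for z by (simp add: th S1_cnjv S1_S1)
  then have th_sq: "th ** th = mat 1"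
    unfolding matrix_eq matrix_vector_mul_assoc[symmetric] matrix_vector_mul_lid by blast

  have id: "id \<in> orthogonal_group E b" by (auto simp: orthogonal_group_def bij_betw_def)
  \<comment> \<open>The orbit of \<open>x'\<close> contains its image under \<open>id\<close>, and
    equality of the orbits then gives \<open>h\<close>. Below, \<open>x'_x\<close> removes
    \<open>id\<close> in coordinates, with \<open>mat 1\<close> as its matrix.\<close>
  have "map (tensor_act E id) x' \<in> tensor_orbit E (orthogonal_group E b) x"
    using rot id unfolding wick_rotatable_def tensor_orbit_def by blast
  then obtain h where h: "h \<in> orthogonal_group E b" "map (tensor_act E id) x' = map (tensor_act E h) x"
    by (auto simp: tensor_orbit_def)
  obtain H where H: "orthogonal_matrix H" "\<And>z. h (vec_of z) = vec_of (H *v z)"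
    using orthogonal_group_obtain_matrix[OF h(1)] by blast

  let ?k = "\<lambda>i. fst (tys ! i)" and ?N = "\<lambda>i. fst (tys ! i) + snd (tys ! i)"
  have len: "length x = length tys" "length x' = length tys"
    using x x' by (auto simp: real_tensor_sum_def dest: list_all2_lengthD)
  have mem_x: "x ! i \<in> real_tensors E V (tys ! i)" "x' ! i \<in> real_tensors E W (tys ! i)"
    if "i < length tys" for i
    using x x' that by (auto simp: real_tensor_sum_def list_all2_conv_all_nth)
  have x'_x: "tform (?k i) (x' ! i) zs = tform (?k i) (x ! i) (map (\<lambda>z. transpose H *v z) zs)"
    if i: "i < length tys" and zs: "length zs = ?N i" for i zs
  proof -
    have "tensor_act E id (x' ! i) = tensor_act E h (x ! i)"
      using h(2) i len by (metis nth_map)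
    moreover have "orthogonal_matrix (mat 1 :: complex^'n^'n)" by (rule orthogonal_matrix_id)
    moreover have "id (vec_of z) = vec_of (mat 1 *v z)" for z by simp
    ultimately have "tform (?k i) (x' ! i) (map (\<lambda>z. transpose (mat 1) *v z) zs)
        = tform (?k i) (x ! i) (map (\<lambda>z. transpose H *v z) zs)"
      using tensor_act_tform[OF id _ _ zs, of "mat 1" "x' ! i"] tensor_act_tform[OF h(1) H zs, of "x ! i"]
      by simp
    then show ?thesis unfolding transpose_mat matrix_vector_mul_lid by simp
  qed

  \<comment> \<open>One form for each summand; all of them come from \<open>x\<close>, with
    \<open>x'\<close> expressed through \<open>H\<close>.\<close>
  define I where "I = (\<lambda>i. (?N i, tform (?k i) (x ! i))) ` {..<length tys}"
  have IE: "\<exists>i < length tys. N = ?N i \<and> T = tform (?k i) (x ! i)" if "(N, T) \<in> I" for N T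
    using that by (auto simp: I_def)
  have I1: "multilinear N T" if "(N, T) \<in> I" for N T
    using IE[OF that] multilinear_tform real_tensors_subset mem_x(1) by blast
  have I2: "T (map (\<lambda>z. th *v cnjv z) zs) = cnj (T zs)" if N: "(N, T) \<in> I" "length zs = N" for N T zs
  proof -
    obtain i where i: "i < length tys" "N = ?N i" "T = tform (?k i) (x ! i)" using IE[OF N(1)] by blast
    have zs: "length zs = ?N i" using N i by simp
    from tform_conjugate[OF mem_x(1)[OF i(1)] V zs] show ?thesis
      unfolding i(3) S1[symmetric] S1_def .
  qed
  \<comment> \<open>By \<open>x'_x\<close> this says that \<open>x'\<close>, the image of
    \<open>x\<close> under \<open>h\<close>, is real with respect to \<open>W\<close>.\<close>
  have I3: "T (map (\<lambda>z. transpose H *v cnjv z) zs) = cnj (T (map (\<lambda>z. transpose H *v z) zs))"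
    if N: "(N, T) \<in> I" "length zs = N" for N T zs
  proof -
    obtain i where i: "i < length tys" "N = ?N i" "T = tform (?k i) (x ! i)" using IE[OF N(1)] by blast
    have zs: "length zs = ?N i" "length (map cnjv zs) = ?N i" using N i by auto
    have "(\<lambda>z. coords (s2 (vec_of z))) = cnjv" by (simp add: fun_eq_iff s2_vec_of)
    with tform_conjugate[OF mem_x(2)[OF i(1)] W zs(1)]
    have "tform (?k i) (x' ! i) (map cnjv zs) = cnj (tform (?k i) (x' ! i) zs)" by simp
    then show ?thesis
      unfolding x'_x[OF i(1) zs(1)] x'_x[OF i(1) zs(2)] i(3) map_map o_def .
  qed
  obtain s r where sr: "orthogonal_matrix s" "orthogonal_matrix r" "th ** cnjm s = s ** th" "cnjm r = r"
    and eq: "\<And>N T zs. (N, T) \<in> I \<Longrightarrow> length zs = N \<Longrightarrow>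
      T (map (\<lambda>z. transpose s *v z) zs) = T (map (\<lambda>z. transpose H *v (transpose r *v z)) zs)"
    by (rule multilinear_real_orbits_meet[of I th H, OF _ th_orth th_cnjm th_sq H(1)])
      (erule I1, erule (1) I2, erule (1) I3, rule that)

  note so = matrix_map_orthogonal_group[OF sr(1)] and ro = matrix_map_orthogonal_group[OF sr(2)]
  have "commute_on E (matrix_map s) s1"
    unfolding commute_on_def
  proof
    fix v assume v: "v \<in> E"
    \<comment> \<open>The relation \<open>sr(3)\<close> is commutation with \<open>S1\<close>; in
      the same way \<open>cnjm r = r\<close> is commutation with \<open>cnjv\<close>.\<close>
    have "s *v S1 (coords v) = S1 (s *v coords v)"
      unfolding S1 cnjv_mult_vec matrix_vector_mul_assoc sr(3) ..
    then have "vec_of (s *v S1 (coords v)) = s1 (vec_of (s *v coords v))" by (simp only: S1_vec_of)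
    then show "matrix_map s (s1 v) = s1 (matrix_map s v)"
      using v by (simp add: matrix_map_def S1_def vec_of_coords)
  qed
  then have sV: "matrix_map s \<in> real_orthogonal_group E b V"
    by (rule commuting_imp_real_orthogonal_group[OF so V(1,3)])
  have "commute_on E (matrix_map r) s2"
    unfolding commute_on_def matrix_map_def
    by (simp add: s2_coords s2_vec_of cnjv_mult_vec sr(4))
  then have rW: "matrix_map r \<in> real_orthogonal_group E b W"
    by (rule commuting_imp_real_orthogonal_group[OF ro W(1,3)])
  have "tensor_act E (matrix_map s) (x ! i) = tensor_act E (matrix_map r) (x' ! i)"
    if i: "i < length tys" for i
  proof (rule tensor_act_eqI[OF _ _ so sr(1) matrix_map_vec_of ro sr(2) matrix_map_vec_of])
    show "x ! i \<in> complex_tensors E (tys ! i)" "x' ! i \<in> complex_tensors E (tys ! i)"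
      by (rule real_tensors_subset, rule mem_x[OF i])+
  next
    fix zs :: "(complex^'n) list" assume zs: "length zs = ?N i"
    have "(?N i, tform (?k i) (x ! i)) \<in> I" using i by (auto simp: I_def)
    \<comment> \<open>On the right of \<open>eq\<close>, composition with \<open>transpose H\<close>
      turns the form of \<open>x\<close> into that of \<open>x'\<close>.\<close>
    from eq[OF this zs] x'_x[OF i, of "map (\<lambda>z. transpose r *v z) zs"] zs
    show "tform (?k i) (x ! i) (map (\<lambda>z. transpose s *v z) zs)
        = tform (?k i) (x' ! i) (map (\<lambda>z. transpose r *v z) zs)"
      by (simp only: map_map o_def length_map)
  qed
  then have "map (tensor_act E (matrix_map s)) x = map (tensor_act E (matrix_map r)) x'"
    using len by (intro nth_equalityI) auto
  then show ?thesis using sV rW unfolding tensor_orbit_def by blast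
qed

section \<open>Passage from the manifolds to their tangent spaces at \<open>m\<close>\<close>

theorem corollary5p7:
  fixes X :: "'m topology" and A :: "('m, 'n::finite) chart set"
    and g :: "'m \<Rightarrow> ('m, 'n) tvec \<Rightarrow> ('m, 'n) tvec \<Rightarrow> complex"
    and P Q :: "'m set" and m :: 'm and p q :: nat
    and tys :: "(nat \<times> nat) list" and x x' :: "(('m, 'n) chart, 'n) tensor list"
  defines "E \<equiv> tangent_space A m"
    and "TP \<equiv> submanifold_tangent_space A P m"
    and "TQ \<equiv> submanifold_tangent_space A Q m"
  assumes "holomorphic_riemannian_manifold X A g"
    and "standard_wick_rotation X A g P Q m"
    and "p + q = CARD('n)"
    and "\<forall>y\<in>P. has_signature (submanifold_tangent_space A P y) (g y) p q"
    and "\<forall>y\<in>Q. positive_definite_on (submanifold_tangent_space A Q y) (g y)"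
    and "x \<in> real_tensor_sum E TP tys" and "x' \<in> real_tensor_sum E TQ tys"
    and "wick_rotatable E (g m) x x'"
  shows "tensor_orbit E (real_orthogonal_group E (g m) TP) x \<inter>
         tensor_orbit E (real_orthogonal_group E (g m) TQ) x' \<noteq> {}"
proof -
  have mP: "m \<in> P" and mQ: "m \<in> Q" and rel: "wick_related X A g P Q"
    and "\<exists>W. compatible_triple E (g m) TP TQ W"
    using assms(5) by (auto simp: standard_wick_rotation_def wick_rotated_def E_def TP_def TQ_def)
  then obtain W where triple: "compatible_triple E (g m) TP TQ W" by blast
  have "m \<in> topspace X"
    using rel mP unfolding wick_related_def real_slice_submanifold_def half_dim_submanifold_def by blast
  then have metric: "complex_metric_on E (g m)"
    using assms(4) by (simp add: holomorphic_riemannian_manifold_def E_def)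
  obtain s1 s2 where s: "conjugation_of E TP s1" "conjugation_of E TQ s2" "commute_on E s1 s2"
    using triple unfolding compatible_triple_def by blast
  have forms: "real_form E TP" "real_slice E (g m) TP" "real_form E TQ" "real_slice E (g m) TQ"
    using triple unfolding compatible_triple_def by blast+
  have "has_signature TP (g m) p q" "positive_definite_on TQ (g m)"
    using assms(7,8) mP mQ by (simp_all add: TP_def TQ_def)
  from real_tensor_orbits_meet[OF metric forms(1,2) s(1) forms(3,4) s(2,3) this(2,1)
      \<open>p + q = CARD('n)\<close> assms(9-11)]
  show ?thesis .
qed

end
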